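(* Let $n\ge1$. The hypercube $Q^n$, with bipartition $E$ = even-size subsets and $O$ = odd-size subsets of $[n]$, has isoperimetric nesting with nest orders weightlex-even on $E$ and weightlex-odd on $O$; consequently $\mathrm{Hun}(Q^n)=u^E(Q^n)+1$.
   Context: $Q^n$ has vertex set the subsets of $[n]$, with $x\sim y$ iff $|x\triangle y|=1$. For subsets $x,y$ of $[n]$: $x\le_{lex}y$ iff $x=y$ or $\min(x\triangle y)\in x$; $x$ precedes $y$ in weightlex order iff $|x|<|y|$, or $|x|=|y|$ and $x<_{lex}y$. Weightlex-even (resp. weightlex-odd) is the restriction of weightlex order to even-size (resp. odd-size) subsets. For $S$ a vertex set, $N(S)$ is the set of vertices adjacent to some vertex of $S$. $\mathrm{mun}^E(k)=\min\{|N(V)|:V\subseteq E,|V|=k\}$, $\mathrm{mun}^O(k)$ analogously, $u^E(G)=\max_{k\ge1}\{\mathrm{mun}^E(k)-k\}$. A bipartite graph with parts $E,O$ has isoperimetric nesting with nest orders $\le_E,\le_O$ (total orders on $E$, $O$) if for every $k$ the neighborhood of the first $k$ elements of $E$ under $\le_E$ equals the first $\mathrm{mun}^E(k)$ elements of $O$ under $\le_O$, and the neighborhood of the first $k$ elements of $O$ under $\le_O$ equals the first $\mathrm{mun}^O(k)$ elements of $E$ under $\le_E$. Hunter number: a hunter strategy is a finite sequence $(H_1,\dots,H_m)$ of multisets of vertices; $R(0)=V(G)$, $R(i)=N(R(i-1)\setminus H_i)$; it is winning if some $R(i)=\emptyset$; $\mathrm{Hun}(G)$ is the minimum over winning strategies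 of $\max_i|H_i|$. *)

theory Defs
  imports Main "HOL-Library.Multiset" "Graph_Theory.Pair_Digraph"
begin

(* Finite simple graphs are the pair_graphs of the library: finite, loop-free, with a symmetric
   arc relation. *)

definition nbhd :: "'a pair_pre_digraph \<Rightarrow> 'a set \<Rightarrow> 'a set" where
  "nbhd G S = {v \<in> pverts G. \<exists>u\<in>S. (u, v) \<in> parcs G}"

definition bipartition :: "'a pair_pre_digraph \<Rightarrow> 'a set \<Rightarrow> 'a set \<Rightarrow> bool" where
  "bipartition G A B \<longleftrightarrow> pair_graph G \<and> A \<union> B = pverts G \<and> A \<inter> B = {} \<and>
     (\<forall>(u, v) \<in> parcs G. (u \<in> A \<and> v \<in> B) \<or> (u \<in> B \<and> v \<in> A))"

(* The minimum is over a nonempty set only for k \<le> card A; larger k are never used. *)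
definition mun :: "'a pair_pre_digraph \<Rightarrow> 'a set \<Rightarrow> nat \<Rightarrow> nat" where
  "mun G A k = Min {card (nbhd G V) | V. V \<subseteq> A \<and> card V = k}"

definition u_max :: "'a pair_pre_digraph \<Rightarrow> 'a set \<Rightarrow> int" where
  "u_max G A = Max {int (mun G A k) - int k | k. 1 \<le> k \<and> k \<le> card A}"

(* A non-strict total order r is given as the set of pairs (y, x) with y below or equal to x, so
   the cardinality below is the rank of x, counted from 1. *)
definition first_elems :: "'a rel \<Rightarrow> 'a set \<Rightarrow> nat \<Rightarrow> 'a set" where
  "first_elems r A k = {x \<in> A. card {y \<in> A. (y, x) \<in> r} \<le> k}"

definition isoperimetric_nesting ::
  "'a pair_pre_digraph \<Rightarrow> 'a set \<Rightarrow> 'a set \<Rightarrow> 'a rel \<Rightarrow> 'a rel \<Rightarrow> bool" where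
  "isoperimetric_nesting G A B rA rB \<longleftrightarrow>
     bipartition G A B \<and> linear_order_on A rA \<and> linear_order_on B rB \<and>
     (\<forall>k \<le> card A. nbhd G (first_elems rA A k) = first_elems rB B (mun G A k)) \<and>
     (\<forall>k \<le> card B. nbhd G (first_elems rB B k) = first_elems rA A (mun G B k))"

(* The i-th entry of the list (from 0) is the multiset shot at in round i + 1; an occurrence
   counts once for each hunter aiming at that vertex. *)
definition hunter_strategy :: "'a pair_pre_digraph \<Rightarrow> 'a multiset list \<Rightarrow> bool" where
  "hunter_strategy G Hs \<longleftrightarrow> Hs \<noteq> [] \<and> (\<forall>H \<in> set Hs. set_mset H \<subseteq> pverts G)"

primrec territory :: "'a pair_pre_digraph \<Rightarrow> 'a multiset list \<Rightarrow> nat \<Rightarrow> 'a set" where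
  "territory G Hs 0 = pverts G"
| "territory G Hs (Suc i) = nbhd G (territory G Hs i - set_mset (Hs ! i))"

definition winning_strategy :: "'a pair_pre_digraph \<Rightarrow> 'a multiset list \<Rightarrow> bool" where
  "winning_strategy G Hs \<longleftrightarrow> hunter_strategy G Hs \<and> (\<exists>i \<le> length Hs. territory G Hs i = {})"

(* The infimum of a nonempty set of naturals is its minimum; on a finite graph, shooting at all
   vertices at once is winning. *)
definition hunter_number :: "'a pair_pre_digraph \<Rightarrow> nat" where
  "hunter_number G = Inf {Max (size ` set Hs) | Hs. winning_strategy G Hs}"

definition hypercube :: "nat \<Rightarrow> nat set pair_pre_digraph" where
  "hypercube n = \<lparr> pverts = Pow {1..n},
     parcs = {(x, y). x \<subseteq> {1..n} \<and> y \<subseteq> {1..n} \<and> card (sym_diff x y) = 1} \<rparr>"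

definition even_sets :: "nat \<Rightarrow> nat set set" where
  "even_sets n = {x. x \<subseteq> {1..n} \<and> even (card x)}"

definition odd_sets :: "nat \<Rightarrow> nat set set" where
  "odd_sets n = {x. x \<subseteq> {1..n} \<and> odd (card x)}"

definition lex_le :: "nat set \<Rightarrow> nat set \<Rightarrow> bool" where
  "lex_le x y \<longleftrightarrow> x = y \<or> Min (sym_diff x y) \<in> x"

definition weightlex_less :: "nat set \<Rightarrow> nat set \<Rightarrow> bool" where
  "weightlex_less x y \<longleftrightarrow> card x < card y \<or> (card x = card y \<and> lex_le x y \<and> x \<noteq> y)"

definition weightlex_on :: "nat set set \<Rightarrow> nat set rel" where
  "weightlex_on A = {(x, y). x \<in> A \<and> y \<in> A \<and> (x = y \<or> weightlex_less x y)}"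

abbreviation weightlex_even :: "nat \<Rightarrow> nat set rel" where
  "weightlex_even n \<equiv> weightlex_on (even_sets n)"

abbreviation weightlex_odd :: "nat \<Rightarrow> nat set rel" where
  "weightlex_odd n \<equiv> weightlex_on (odd_sets n)"

end

theory Submission
  imports Defs
begin

text \<open>
  The isoperimetric inequality is proved by compression, as for Harper's theorem, but inside one
  parity class. Splitting a family at a coordinate \<open>i\<close> gives one family of each parity in the
  smaller cube, and replacing both by initial segments does not enlarge the neighbourhood, since
  neighbourhoods of initial segments are initial segments and hence nested. A family of least rank
  sum among those of the given size with no larger neighbourhood is thus compressed in every
  direction; if it still misses some \<open>x\<close> below a member \<open>y\<close>, then \<open>y\<close> is the complement and the
  immediate successor of \<open>x\<close>, and exchanging \<open>y\<close> for \<open>x\<close> contradicts minimality.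

  For the hunters, if the possible positions in one class number at least \<open>mun k\<close> for a \<open>k\<close> that
  maximises \<open>mun k - k\<close>, then this persists against \<open>mun k - k\<close> hunters. With one more hunter,
  keeping the positions an initial segment makes it strictly shorter in each round, so the two
  classes can be cleared one after the other.
\<close>

section \<open>Initial segments and the weightlex order\<close>

text \<open>A form without cardinalities, which can be checked directly for a neighbourhood;
  \<open>initial_segment_eq_first_elems\<close> turns it back into
  \<open>first_elems\<close>.\<close>

definition initial_segment :: "'a rel \<Rightarrow> 'a set \<Rightarrow> 'a set \<Rightarrow> bool" where
  "initial_segment r A D \<longleftrightarrow> D \<subseteq> A \<and> (\<forall>x\<in>D. \<forall>y\<in>A. (y, x) \<in> r \<longrightarrow> y \<in> D)"

text \<open>The cardinality inside \<open>first_elems\<close>; it also serves as the weight that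
  compression decreases.\<close>

definition rank_in :: "'a rel \<Rightarrow> 'a set \<Rightarrow> 'a \<Rightarrow> nat" where
  "rank_in r A x = card {y \<in> A. (y, x) \<in> r}"

lemma rank_in_less:
  assumes "linear_order_on A r" "finite A" "x \<in> A" "y \<in> A" "(x, y) \<in> r" "x \<noteq> y"
  shows "rank_in r A x < rank_in r A y"
  unfolding rank_in_def
proof (rule psubset_card_mono)
  have "trans r" "antisym r" "refl_on A r"
    using assms(1) by (auto simp: order_on_defs)
  then have "{z \<in> A. (z, x) \<in> r} \<subseteq> {z \<in> A. (z, y) \<in> r}" "(y, x) \<notin> r" "(y, y) \<in> r"
    using assms by (auto dest: transD antisymD simp: refl_on_def)
  then show "{z \<in> A. (z, x) \<in> r} \<subset> {z \<in> A. (z, y) \<in> r}"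
    using assms(4) by blast
qed (use assms in auto)

lemma bij_betw_rank_in:
  assumes "linear_order_on A r" "finite A"
  shows "bij_betw (rank_in r A) A {1..card A}"
proof -
  have inj: "inj_on (rank_in r A) A"
  proof (rule inj_onI, rule ccontr)
    fix x y assume "x \<in> A" "y \<in> A" "rank_in r A x = rank_in r A y" "x \<noteq> y"
    moreover from this have "(x, y) \<in> r \<or> (y, x) \<in> r"
      using assms(1) by (auto simp: order_on_defs total_on_def)
    ultimately show False
      using rank_in_less[OF assms] by (metis less_irrefl)
  qed
  have "rank_in r A x \<in> {1..card A}" if "x \<in> A" for x
  proof -
    have "x \<in> {y \<in> A. (y, x) \<in> r}"
      using that assms(1) by (auto simp: order_on_defs refl_on_def)
    moreover have "finite {y \<in> A. (y, x) \<in> r}"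
      using assms(2) by simp
    ultimately have "1 \<le> rank_in r A x"
      unfolding rank_in_def by (metis One_nat_def Suc_leI card_gt_0_iff empty_iff)
    then show ?thesis
      using assms(2) by (auto simp: rank_in_def intro: card_mono)
  qed
  then have "rank_in r A ` A \<subseteq> {1..card A}"
    by blast
  moreover have "card (rank_in r A ` A) = card {1..card A}"
    using inj by (simp add: card_image)
  ultimately show ?thesis
    using inj by (simp add: bij_betw_def card_subset_eq)
qed

lemma card_first_elems:
  assumes "linear_order_on A r" "finite A" "k \<le> card A"
  shows "card (first_elems r A k) = k"
proof -
  note bij = bij_betw_rank_in[OF assms(1,2)]
  have "rank_in r A ` first_elems r A k = {1..k}"
  proof
    show "rank_in r A ` first_elems r A k \<subseteq> {1..k}"
      using bij by (auto simp: first_elems_def rank_in_def bij_betw_def)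
    show "{1..k} \<subseteq> rank_in r A ` first_elems r A k"
    proof
      fix j assume j: "j \<in> {1..k}"
      then have "j \<in> rank_in r A ` A"
        using bij assms(3) by (auto simp: bij_betw_def)
      with j show "j \<in> rank_in r A ` first_elems r A k"
        by (auto simp: first_elems_def rank_in_def)
    qed
  qed
  moreover have "inj_on (rank_in r A) (first_elems r A k)"
    using bij by (auto simp: bij_betw_def first_elems_def intro: inj_on_subset)
  ultimately show ?thesis
    by (metis card_atLeastAtMost card_image diff_Suc_1)
qed

lemma first_elems_subset: "first_elems r A k \<subseteq> A"
  by (auto simp: first_elems_def)

lemma first_elems_mono: "j \<le> k \<Longrightarrow> first_elems r A j \<subseteq> first_elems r A k"
  by (auto simp: first_elems_def)

lemma first_elems_0:
  assumes "linear_order_on A r" "finite A"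
  shows "first_elems r A 0 = {}"
  using card_first_elems[OF assms, of 0] assms(2)
  by (simp add: finite_subset[OF first_elems_subset])

lemma first_elems_card:
  assumes "linear_order_on A r" "finite A"
  shows "first_elems r A (card A) = A"
  using card_first_elems[OF assms, of "card A"] assms(2)
  by (simp add: card_subset_eq first_elems_subset)

lemma initial_segment_first_elems:
  assumes "linear_order_on A r" "finite A"
  shows "initial_segment r A (first_elems r A k)"
proof -
  have "trans r"
    using assms(1) by (simp add: order_on_defs)
  then have "card {z \<in> A. (z, y) \<in> r} \<le> card {z \<in> A. (z, x) \<in> r}" if "(y, x) \<in> r" for x y
    using that assms(2) by (intro card_mono) (auto dest: transD)
  then show ?thesis
    unfolding initial_segment_def first_elems_def by (auto intro: order_trans)
qed

text \<open>Everything below a member of \<open>D\<close> lies in \<open>D\<close>, so the rank of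
  that member is at most \<open>card D\<close>; the resulting inclusion is an equality because both
  sides have the same size.\<close>

lemma initial_segment_eq_first_elems:
  assumes "linear_order_on A r" "finite A" "initial_segment r A D"
  shows "D = first_elems r A (card D)"
proof -
  have D: "D \<subseteq> A" "finite D"
    using assms by (auto simp: initial_segment_def finite_subset)
  have "D \<subseteq> first_elems r A (card D)"
  proof
    fix x assume "x \<in> D"
    then have "{y \<in> A. (y, x) \<in> r} \<subseteq> D"
      using assms(3) by (auto simp: initial_segment_def)
    then show "x \<in> first_elems r A (card D)"
      using \<open>x \<in> D\<close> D by (auto simp: first_elems_def intro: card_mono)
  qed
  moreover have "card (first_elems r A (card D)) = card D"
    using D assms by (intro card_first_elems) (auto intro: card_mono)
  ultimately show ?thesis
    using assms(2) by (intro card_subset_eq finite_subset[OF first_elems_subset]) auto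
qed

lemma initial_segment_nested:
  assumes "linear_order_on A r" "finite A" "initial_segment r A D" "initial_segment r A D'"
    and "card D \<le> card D'"
  shows "D \<subseteq> D'"
  using initial_segment_eq_first_elems[OF assms(1-3)] initial_segment_eq_first_elems[OF assms(1,2,4)]
    first_elems_mono[OF assms(5)] by metis

text \<open>The sets \<open>D - S\<close> and \<open>S - D\<close> have equal size and every element
  of the first lies below every element of the second, so any bijection between them increases
  \<open>f\<close>. This is why compression strictly lowers the rank sum.\<close>

lemma sum_initial_segment_less:
  fixes f :: "'a \<Rightarrow> nat"
  assumes lin: "linear_order_on A r" and fin: "finite A" and D: "initial_segment r A D"
    and S: "S \<subseteq> A" "card S = card D" "S \<noteq> D"
    and f: "\<And>x y. x \<in> A \<Longrightarrow> y \<in> A \<Longrightarrow> (x, y) \<in> r \<Longrightarrow> x \<noteq> y \<Longrightarrow> f x < f y"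
  shows "sum f D < sum f S"
proof -
  have DA: "D \<subseteq> A"
    using D by (simp add: initial_segment_def)
  have fDS: "finite D" "finite S"
    using fin DA S(1) by (auto intro: finite_subset)
  have less: "f x < f y" if "x \<in> D - S" "y \<in> S - D" for x y
  proof -
    have "(y, x) \<notin> r"
      using D that S(1) by (auto simp: initial_segment_def)
    moreover have "x \<in> A" "y \<in> A" "x \<noteq> y"
      using that DA S(1) by auto
    ultimately have "(x, y) \<in> r"
      using lin unfolding order_on_defs total_on_def by blast
    then show ?thesis
      using f that DA S(1) by auto
  qed
  have c: "card (D - S) = card (S - D)"
    using fDS S(2) by (simp add: card_Diff_subset_Int inf_commute)
  then obtain h where h: "bij_betw h (D - S) (S - D)"
    using fDS finite_same_card_bij by blast
  have ne: "D - S \<noteq> {}"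
    using c S(2,3) fDS by (metis card_subset_eq Diff_eq_empty_iff)
  have "sum f (D - S) < sum (\<lambda>x. f (h x)) (D - S)"
    using fDS ne h less by (intro sum_strict_mono) (auto simp: bij_betw_def)
  also have "\<dots> = sum f (S - D)"
    using h by (rule sum.reindex_bij_betw)
  finally have "sum f (D - S) < sum f (S - D)" .
  moreover have "sum f D = sum f (D - S) + sum f (D \<inter> S)" "sum f S = sum f (S - D) + sum f (D \<inter> S)"
    using fDS by (metis sum.Int_Diff add.commute inf_commute)+
  ultimately show ?thesis
    by simp
qed

section \<open>The lexicographic order by first difference, and the weightlex order\<close>

definition lex_less :: "nat set \<Rightarrow> nat set \<Rightarrow> bool" where
  "lex_less x y \<longleftrightarrow> (\<exists>a. a \<in> x \<and> a \<notin> y \<and> (\<forall>b<a. b \<in> x \<longleftrightarrow> b \<in> y))"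

text \<open>Replaces \<open>Min\<close> by an explicit first difference; totality and transitivity
  of \<open>lex_less\<close> then hold for arbitrary sets.\<close>

lemma lex_le_iff:
  assumes "finite x" "finite y"
  shows "lex_le x y \<and> x \<noteq> y \<longleftrightarrow> lex_less x y"
proof
  assume L: "lex_le x y \<and> x \<noteq> y"
  let ?D = "sym_diff x y"
  have D: "finite ?D" "?D \<noteq> {}"
    using assms L by auto
  have "Min ?D \<in> ?D" "Min ?D \<in> x" "\<forall>b<Min ?D. b \<notin> ?D"
    using Min_in[OF D] L Min_le[OF D(1)] by (auto simp: lex_le_def simp del: Un_iff Diff_iff dest: leD)
  then show "lex_less x y"
    unfolding lex_less_def by blast
next
  assume "lex_less x y"
  then obtain a where a: "a \<in> x" "a \<notin> y" "\<forall>b<a. b \<in> x \<longleftrightarrow> b \<in> y"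
    unfolding lex_less_def by blast
  then have "Min (sym_diff x y) = a"
    using assms by (intro Min_eqI) (auto intro: leI)
  with a show "lex_le x y \<and> x \<noteq> y"
    by (auto simp: lex_le_def)
qed

lemma weightlex_less_iff:
  assumes "finite x" "finite y"
  shows "weightlex_less x y \<longleftrightarrow> card x < card y \<or> card x = card y \<and> lex_less x y"
  using lex_le_iff[OF assms] by (auto simp: weightlex_less_def)

lemma lex_less_total:
  assumes "x \<noteq> y"
  shows "lex_less x y \<or> lex_less y x"
proof -
  define a where "a = (LEAST a. (a \<in> x) \<noteq> (a \<in> y))"
  have "\<exists>a. (a \<in> x) \<noteq> (a \<in> y)"
    using assms by blast
  then have "(a \<in> x) \<noteq> (a \<in> y)"
    unfolding a_def by (rule LeastI_ex)
  moreover have "\<forall>b<a. (b \<in> x) = (b \<in> y)"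
    using not_less_Least unfolding a_def by blast
  ultimately show ?thesis
    unfolding lex_less_def by metis
qed

lemma lex_less_trans: "lex_less x y \<Longrightarrow> lex_less y z \<Longrightarrow> lex_less x z"
  unfolding lex_less_def
proof (elim exE conjE)
  fix a b
  assume *: "a \<in> x" "a \<notin> y" "\<forall>c<a. c \<in> x \<longleftrightarrow> c \<in> y" "b \<in> y" "b \<notin> z" "\<forall>c<b. c \<in> y \<longleftrightarrow> c \<in> z"
  then have "a \<noteq> b"
    by blast
  \<comment> \<open>The smaller of the two first differences decides between \<open>x\<close> and
    \<open>z\<close>.\<close>
  with * have "min a b \<in> x" "min a b \<notin> z"
    by (cases "a < b"; auto simp: min_def)+
  moreover have "\<forall>c<min a b. c \<in> x \<longleftrightarrow> c \<in> z"
    using * by simp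
  ultimately show "\<exists>a. a \<in> x \<and> a \<notin> z \<and> (\<forall>c<a. c \<in> x \<longleftrightarrow> c \<in> z)"
    by blast
qed

lemma weightlex_less_irrefl: "\<not> weightlex_less x x"
  by (simp add: weightlex_less_def)

lemma weightlex_less_trans:
  assumes "finite x" "finite y" "finite z" "weightlex_less x y" "weightlex_less y z"
  shows "weightlex_less x z"
  using assms by (auto simp: weightlex_less_iff intro: lex_less_trans)

lemma weightlex_less_total:
  assumes "finite x" "finite y" "x \<noteq> y"
  shows "weightlex_less x y \<or> weightlex_less y x"
  using assms lex_less_total[of x y] by (auto simp: weightlex_less_iff)

text \<open>A common new element raises both sizes by one and is never the first difference. Hence
  sets containing \<open>i\<close> are ordered as the same sets without \<open>i\<close>.\<close>

lemma weightlex_less_insert: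
  assumes "finite x" "finite y" "i \<notin> x" "i \<notin> y"
  shows "weightlex_less (insert i x) (insert i y) \<longleftrightarrow> weightlex_less x y"
proof -
  have "lex_less (insert i x) (insert i y) \<longleftrightarrow> lex_less x y"
    unfolding lex_less_def
  proof (rule ex_cong1)
    fix a
    have "(b \<in> insert i x \<longleftrightarrow> b \<in> insert i y) \<longleftrightarrow> (b \<in> x \<longleftrightarrow> b \<in> y)" for b
      using assms(3,4) by auto
    then show "(a \<in> insert i x \<and> a \<notin> insert i y \<and> (\<forall>b<a. b \<in> insert i x \<longleftrightarrow> b \<in> insert i y)) \<longleftrightarrow>
        (a \<in> x \<and> a \<notin> y \<and> (\<forall>b<a. b \<in> x \<longleftrightarrow> b \<in> y))"
      using assms(3) by auto
  qed
  then show ?thesis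
    using assms by (simp add: weightlex_less_iff)
qed

lemma weightlex_linear_order:
  assumes fin: "\<And>x. x \<in> A \<Longrightarrow> finite x"
  shows "linear_order_on A (weightlex_on A)"
  unfolding order_on_defs
proof (intro conjI transI antisymI)
  fix x y z assume "(x, y) \<in> weightlex_on A" "(y, z) \<in> weightlex_on A"
  then show "(x, z) \<in> weightlex_on A"
    using weightlex_less_trans[of x y z] fin by (auto simp: weightlex_on_def)
next
  fix x y assume "(x, y) \<in> weightlex_on A" "(y, x) \<in> weightlex_on A"
  then show "x = y"
    using weightlex_less_trans[of x y x] weightlex_less_irrefl[of x] fin
    by (auto simp: weightlex_on_def)
next
  show "total_on A (weightlex_on A)"
    using fin weightlex_less_total by (auto simp: weightlex_on_def total_on_def)
qed (auto simp: weightlex_on_def refl_on_def)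

lemma initial_segment_weightlex_iff:
  "initial_segment (weightlex_on A) A D \<longleftrightarrow>
     D \<subseteq> A \<and> (\<forall>x\<in>D. \<forall>y\<in>A. weightlex_less y x \<longrightarrow> y \<in> D)"
  by (auto simp: initial_segment_def weightlex_on_def)

section \<open>Isoperimetry in a parity class of the cube\<close>

text \<open>An arbitrary ground set and a parity flag (\<open>True\<close> for even) let the
  induction delete any coordinate, which reverses the parity in one of the halves.\<close>

definition cube_class :: "nat set \<Rightarrow> bool \<Rightarrow> nat set set" where
  "cube_class X p = {x. x \<subseteq> X \<and> (even (card x) \<longleftrightarrow> p)}"

definition toggle :: "nat \<Rightarrow> nat set \<Rightarrow> nat set" where
  "toggle i x = (if i \<in> x then x - {i} else insert i x)"

definition cube_nbhd :: "nat set \<Rightarrow> nat set set \<Rightarrow> nat set set" where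
  "cube_nbhd X S = {w. w \<subseteq> X \<and> (\<exists>i\<in>X. toggle i w \<in> S)}"

abbreviation seg :: "nat set \<Rightarrow> bool \<Rightarrow> nat \<Rightarrow> nat set set" where
  "seg X p k \<equiv> first_elems (weightlex_on (cube_class X p)) (cube_class X p) k"

abbreviation is_seg :: "nat set \<Rightarrow> bool \<Rightarrow> nat set set \<Rightarrow> bool" where
  "is_seg X p D \<equiv> initial_segment (weightlex_on (cube_class X p)) (cube_class X p) D"

lemma toggle_toggle [simp]: "toggle i (toggle i x) = x"
  by (auto simp: toggle_def)

lemma toggle_subset: "i \<in> X \<Longrightarrow> x \<subseteq> X \<Longrightarrow> toggle i x \<subseteq> X"
  by (auto simp: toggle_def)

lemma even_card_toggle: "finite x \<Longrightarrow> even (card (toggle i x)) \<longleftrightarrow> odd (card x)"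
  by (auto simp: toggle_def card_Diff_singleton_if card_gt_0_iff)

lemma finite_cube_class: "finite X \<Longrightarrow> finite (cube_class X p)"
  by (simp add: cube_class_def)

lemma cube_class_finite: "finite X \<Longrightarrow> x \<in> cube_class X p \<Longrightarrow> finite x"
  by (auto simp: cube_class_def finite_subset)

lemma cube_class_linear_order:
  "finite X \<Longrightarrow> linear_order_on (cube_class X p) (weightlex_on (cube_class X p))"
  by (rule weightlex_linear_order) (rule cube_class_finite)

lemmas cube_class_order = cube_class_linear_order finite_cube_class

lemma toggle_cube_class:
  "finite X \<Longrightarrow> i \<in> X \<Longrightarrow> x \<in> cube_class X p \<Longrightarrow> toggle i x \<in> cube_class X (\<not> p)"
  by (auto simp: cube_class_def toggle_subset even_card_toggle finite_subset)

lemma cube_nbhd_mono: "S \<subseteq> T \<Longrightarrow> cube_nbhd X S \<subseteq> cube_nbhd X T"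
  by (auto simp: cube_nbhd_def)

lemma cube_nbhd_Un: "cube_nbhd X (S \<union> T) = cube_nbhd X S \<union> cube_nbhd X T"
  by (auto simp: cube_nbhd_def)

lemma finite_cube_nbhd: "finite X \<Longrightarrow> finite (cube_nbhd X S)"
  by (simp add: cube_nbhd_def)

lemma cube_nbhd_subset:
  assumes "finite X" "S \<subseteq> cube_class X p"
  shows "cube_nbhd X S \<subseteq> cube_class X (\<not> p)"
proof
  fix w assume "w \<in> cube_nbhd X S"
  then obtain i where "i \<in> X" "toggle i w \<in> cube_class X p"
    using assms(2) by (auto simp: cube_nbhd_def)
  then show "w \<in> cube_class X (\<not> p)"
    using toggle_cube_class[OF assms(1), of i "toggle i w" p] by simp
qed

section \<open>Least neighbours, and neighbourhoods of initial segments\<close>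

definition lower_nbr :: "nat set \<Rightarrow> nat set \<Rightarrow> nat set" where
  "lower_nbr X w = (if w = {} then {Min X} else w - {Max w})"

lemma weightlex_less_singleton:
  "weightlex_less {i} {j} \<longleftrightarrow> i < j"
  by (auto simp: weightlex_less_iff lex_less_def linorder_neq_iff)

lemma lower_nbr_toggle:
  assumes "finite X" "X \<noteq> {}" "w \<subseteq> X"
  shows "\<exists>i\<in>X. lower_nbr X w = toggle i w"
proof (cases "w = {}")
  case True
  then show ?thesis
    using assms by (intro bexI[of _ "Min X"]) (auto simp: lower_nbr_def toggle_def)
next
  case False
  have "Max w \<in> w"
    using assms False by (intro Max_in) (auto intro: finite_subset)
  then show ?thesis
    using False assms by (intro bexI[of _ "Max w"]) (auto simp: lower_nbr_def toggle_def)
qed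

text \<open>Deletions precede insertions by size. Among deletions, that of \<open>Max w\<close>
  comes first, because removing a smaller \<open>i\<close> instead makes \<open>i\<close> the first
  difference, to the advantage of \<open>w - {Max w}\<close>. The empty set admits only insertions,
  the least being \<open>{Min X}\<close>.\<close>

lemma lower_nbr_least:
  assumes "finite X" "i \<in> X" "w \<subseteq> X" "toggle i w \<noteq> lower_nbr X w"
  shows "weightlex_less (lower_nbr X w) (toggle i w)"
proof (cases "w = {}")
  case True
  then show ?thesis
    using assms by (auto simp: lower_nbr_def toggle_def weightlex_less_singleton less_le)
next
  case False
  have fw: "finite w"
    using assms by (auto intro: finite_subset)
  have M: "Max w \<in> w"
    using fw False by (rule Max_in)
  have L: "lower_nbr X w = w - {Max w}"
    using False by (simp add: lower_nbr_def)
  show ?thesis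
  proof (cases "i \<in> w")
    case True
    then have "i < Max w"
      using assms(4) fw L by (auto simp: toggle_def less_le)
    then have "lex_less (w - {Max w}) (w - {i})"
      unfolding lex_less_def using True by (intro exI[of _ i]) auto
    then show ?thesis
      using True L M fw by (simp add: toggle_def weightlex_less_iff)
  next
    case False
    then show ?thesis
      using L M fw by (auto simp: toggle_def weightlex_less_iff card_Diff_singleton_if
          intro: le_less_trans[OF diff_le_self])
  qed
qed

text \<open>Let \<open>a\<close> be the first difference. If \<open>a = Max v\<close>, equal sizes
  force \<open>w\<close> to be \<open>v - {a}\<close> with one larger element, and removing the
  maxima gives the same set. Otherwise \<open>a\<close> lies below both maxima and remains the first
  difference.\<close>

lemma lex_less_remove_Max:
  assumes "finite v" "finite w" "v \<noteq> {}" "card v = card w" "lex_less v w"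
  shows "v - {Max v} = w - {Max w} \<or> lex_less (v - {Max v}) (w - {Max w})"
proof -
  have w: "w \<noteq> {}"
    using assms by auto
  have Mv: "Max v \<in> v" and Mw: "Max w \<in> w"
    using assms w by auto
  obtain a where a: "a \<in> v" "a \<notin> w" and below: "\<And>b. b < a \<Longrightarrow> b \<in> v \<longleftrightarrow> b \<in> w"
    using assms(5) unfolding lex_less_def by blast
  show ?thesis
  proof (cases "a = Max v")
    case True
    have less: "b < a" if "b \<in> v - {a}" for b
      using that assms(1) True by (auto simp: less_le)
    have sub: "v - {a} \<subseteq> w"
      using less below by blast
    have "card (w - (v - {a})) = 1"
      using sub assms a card_gt_0_iff[of v] by (subst card_Diff_subset) (auto simp: card_Diff_singleton_if)
    then obtain c where c: "w - (v - {a}) = {c}"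
      by (auto simp: card_1_singleton_iff)
    then have "c \<in> w" "c \<notin> v - {a}" "c \<noteq> a"
      using a by auto
    then have "a < c"
      using below by (metis Diff_iff linorder_neqE_nat singletonD)
    have weq: "w = insert c (v - {a})"
      using c sub by blast
    have "Max w = c"
      using less_trans[OF less \<open>a < c\<close>] weq assms(2) by (intro Max_eqI) (auto intro: less_imp_le)
    then show ?thesis
      using weq \<open>c \<notin> v - {a}\<close> True by auto
  next
    case False
    have "a < Max v"
      using False a assms(1) by (auto simp: less_le)
    \<comment> \<open>Otherwise all of \<open>w\<close> lies below \<open>a\<close>, hence inside
      \<open>v - {a}\<close>, against equal sizes.\<close>
    have "a < Max w"
    proof (rule ccontr)
      assume "\<not> a < Max w"
      then have "w \<subseteq> v - {a}"
        using assms(2) a below by (auto simp: not_less) (metis Max_ge le_less_trans less_le order_trans)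
      then have "card w < card v"
        using a assms(1) by (metis card_Diff1_less card_mono finite_Diff le_less_trans)
      then show False
        using assms(4) by simp
    qed
    then have "lex_less (v - {Max v}) (w - {Max w})"
      unfolding lex_less_def using a below \<open>a < Max v\<close> by (intro exI[of _ a]) auto
    then show ?thesis ..
  qed
qed

text \<open>Monotonicity is only weak, since sets differing in their maximum alone share a lower
  neighbour. The empty set is treated separately, as its lower neighbour arises by
  insertion.\<close>

lemma lower_nbr_mono:
  assumes "finite X" "v \<in> cube_class X p" "w \<in> cube_class X p" "weightlex_less v w"
  shows "lower_nbr X v = lower_nbr X w \<or> weightlex_less (lower_nbr X v) (lower_nbr X w)"
proof -
  have fin: "finite v" "finite w"
    using assms cube_class_finite by blast+
  have sub: "v \<subseteq> X" "w \<subseteq> X" and par: "even (card v) \<longleftrightarrow> even (card w)"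
    using assms(2,3) by (auto simp: cube_class_def)
  have w: "w \<noteq> {}"
    using assms(4) fin by (auto simp: weightlex_less_iff lex_less_def)
  have Mw: "Max w \<in> w"
    using fin w by auto
  show ?thesis
  proof (cases "v = {}")
    case True
    \<comment> \<open>Since \<open>w\<close> is nonempty and even, removing its maximum leaves
      either one element, which is at least \<open>Min X\<close>, or more than one.\<close>
    have cw: "card w \<noteq> 0" "even (card w)"
      using w fin par True by auto
    show ?thesis
    proof (cases "card w = 2")
      case True
      then have "card (w - {Max w}) = 1"
        using Mw fin by simp
      then obtain c where c: "w - {Max w} = {c}"
        by (auto simp: card_1_singleton_iff)
      then have "Min X \<le> c"
        using sub assms(1) by auto
      then show ?thesis
        using c \<open>v = {}\<close> w by (auto simp: lower_nbr_def weightlex_less_singleton less_le)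
    next
      case False
      then have "card w > 2"
        using cw by presburger
      then have "card (w - {Max w}) > 1"
        using Mw fin by simp
      then show ?thesis
        using \<open>v = {}\<close> w fin by (simp add: lower_nbr_def weightlex_less_iff)
    qed
  next
    case False
    then have Mv: "Max v \<in> v"
      using fin by auto
    have L: "lower_nbr X v = v - {Max v}" "lower_nbr X w = w - {Max w}"
      using False w by (auto simp: lower_nbr_def)
    show ?thesis
    proof (cases "card v = card w")
      case True
      then show ?thesis
        using lex_less_remove_Max[of v w] assms(4) fin False L Mv Mw
        by (auto simp: weightlex_less_iff)
    next
      case neq: False
      then have "card v < card w"
        using assms(4) fin by (simp add: weightlex_less_iff)
      moreover have "card v \<noteq> 0"
        using False fin by simp
      ultimately have "card v - 1 < card w - 1"
        by linarith
      then have "card (v - {Max v}) < card (w - {Max w})"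
        using Mv Mw fin by (simp only: card_Diff_singleton)
      then show ?thesis
        using L fin by (simp add: weightlex_less_iff)
    qed
  qed
qed

text \<open>A set of the opposite class lies in the neighbourhood of an initial segment exactly when
  its least neighbour lies in the segment; \<open>lower_nbr_mono\<close> then gives closure
  downwards.\<close>

lemma cube_nbhd_is_seg:
  assumes X: "finite X" and D: "is_seg X p D"
  shows "is_seg X (\<not> p) (cube_nbhd X D)"
  unfolding initial_segment_weightlex_iff
proof (intro conjI ballI impI)
  have DC: "D \<subseteq> cube_class X p"
    and down: "\<And>x y. x \<in> D \<Longrightarrow> y \<in> cube_class X p \<Longrightarrow> weightlex_less y x \<Longrightarrow> y \<in> D"
    using D by (auto simp: initial_segment_weightlex_iff)
  show sub: "cube_nbhd X D \<subseteq> cube_class X (\<not> p)"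
    using cube_nbhd_subset[OF X DC] .
  fix w v assume w: "w \<in> cube_nbhd X D" and v: "v \<in> cube_class X (\<not> p)" and less: "weightlex_less v w"
  obtain i where i: "i \<in> X" "toggle i w \<in> D" "w \<subseteq> X"
    using w by (auto simp: cube_nbhd_def)
  have vX: "v \<subseteq> X"
    using v by (simp add: cube_class_def)
  have inC: "lower_nbr X u \<in> cube_class X p" if "u \<in> cube_class X (\<not> p)" for u
  proof -
    have "u \<subseteq> X"
      using that by (simp add: cube_class_def)
    then obtain j where "j \<in> X" "lower_nbr X u = toggle j u"
      using lower_nbr_toggle[of X u] X i by auto
    then show ?thesis
      using toggle_cube_class[OF X _ that] by simp
  qed
  have "lower_nbr X w \<in> D"
    using lower_nbr_least[OF X i(1,3)] down[OF i(2) inC] w sub i(2) by fastforce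
  then have "lower_nbr X v \<in> D"
    using lower_nbr_mono[OF X v _ less] down inC v w sub by (metis subsetD)
  moreover obtain j where "j \<in> X" "lower_nbr X v = toggle j v"
    using lower_nbr_toggle[OF X _ vX] i by auto
  ultimately show "v \<in> cube_nbhd X D"
    using vX by (auto simp: cube_nbhd_def)
qed

section \<open>Splitting a family at a coordinate, and compression\<close>

definition low :: "nat \<Rightarrow> nat set set \<Rightarrow> nat set set" where
  "low i B = {b \<in> B. i \<notin> b}"

text \<open>The coordinate is removed so that both halves live in the same smaller cube, this one
  with the opposite parity.\<close>

definition high :: "nat \<Rightarrow> nat set set \<Rightarrow> nat set set" where
  "high i B = {b. i \<notin> b \<and> insert i b \<in> B}"

lemma low_high_decomp: "B = low i B \<union> insert i ` high i B"
proof -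
  have "b \<in> insert i ` high i B" if "b \<in> B" "i \<in> b" for b
    using that by (intro image_eqI[of _ _ "b - {i}"]) (auto simp: high_def insert_absorb)
  then show ?thesis
    by (auto simp: low_def high_def)
qed

lemma low_Un_insert: "\<forall>b\<in>S \<union> T. i \<notin> b \<Longrightarrow> low i (S \<union> insert i ` T) = S"
  by (auto simp: low_def)

lemma high_Un_insert:
  assumes "\<forall>b\<in>S \<union> T. i \<notin> b"
  shows "high i (S \<union> insert i ` T) = T"
proof -
  have "b = b'" if "i \<notin> b" "b' \<in> T" "insert i b = insert i b'" for b b'
    using that assms by (metis UnCI insert_ident)
  then show ?thesis
    using assms by (auto simp: high_def)
qed

lemma inj_on_insert_high: "inj_on (insert i) (high i B)"
  by (rule inj_onI) (auto simp: high_def insert_ident)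

lemma finite_low_high: "finite B \<Longrightarrow> finite (low i B)" "finite B \<Longrightarrow> finite (high i B)"
proof -
  assume "finite B"
  then show "finite (low i B)"
    by (simp add: low_def)
  have "insert i ` high i B \<subseteq> B"
    by (auto simp: high_def)
  then have "finite (insert i ` high i B)"
    using \<open>finite B\<close> by (rule finite_subset)
  then show "finite (high i B)"
    using inj_on_insert_high by (rule finite_imageD)
qed

lemma sum_low_high:
  fixes f :: "nat set \<Rightarrow> nat"
  assumes "finite B"
  shows "sum f B = sum f (low i B) + (\<Sum>b\<in>high i B. f (insert i b))"
proof -
  have "sum f B = sum f (low i B \<union> insert i ` high i B)"
    using low_high_decomp[of B i] by simp
  also have "\<dots> = sum f (low i B) + sum f (insert i ` high i B)"
    using finite_low_high[OF assms] by (intro sum.union_disjoint) (auto simp: low_def)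
  also have "sum f (insert i ` high i B) = (\<Sum>b\<in>high i B. f (insert i b))"
    by (simp add: sum.reindex inj_on_insert_high)
  finally show ?thesis .
qed

lemma card_low_high: "finite B \<Longrightarrow> card B = card (low i B) + card (high i B)"
  using sum_low_high[of B "\<lambda>_. 1" i] by simp

lemma low_cube_class:
  "i \<notin> X \<Longrightarrow> B \<subseteq> cube_class (insert i X) p \<Longrightarrow> low i B \<subseteq> cube_class X p"
  by (auto simp: low_def cube_class_def)

lemma high_cube_class:
  assumes "finite X" "i \<notin> X" "B \<subseteq> cube_class (insert i X) p"
  shows "high i B \<subseteq> cube_class X (\<not> p)"
proof
  fix b assume "b \<in> high i B"
  then have b: "i \<notin> b" "insert i b \<in> cube_class (insert i X) p"
    using assms(3) by (auto simp: high_def)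
  then have "b \<subseteq> X" "finite b"
    using assms(1) by (auto simp: cube_class_def intro: finite_subset)
  then show "b \<in> cube_class X (\<not> p)"
    using b by (auto simp: cube_class_def)
qed

lemma insert_cube_class:
  assumes "finite X" "i \<notin> X"
  shows "x \<in> cube_class X (\<not> p) \<Longrightarrow> insert i x \<in> cube_class (insert i X) p"
  using assms by (auto simp: cube_class_def finite_subset card_insert_if split: if_splits)

text \<open>From a set without \<open>i\<close>, one either toggles inside \<open>X\<close> and
  stays in the low half, or inserts \<open>i\<close> and lands in the high half. Thus direction
  \<open>i\<close> contributes the other half itself.\<close>

lemma low_cube_nbhd:
  assumes "i \<notin> X" "B \<subseteq> Pow (insert i X)"
  shows "low i (cube_nbhd (insert i X) B) = cube_nbhd X (low i B) \<union> high i B"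
proof (rule set_eqI)
  fix w
  have "w \<in> low i (cube_nbhd (insert i X) B) \<longleftrightarrow>
      w \<subseteq> X \<and> i \<notin> w \<and> (insert i w \<in> B \<or> (\<exists>j\<in>X. toggle j w \<in> B))"
    by (auto simp: low_def cube_nbhd_def toggle_def)
  also have "\<dots> \<longleftrightarrow> w \<in> cube_nbhd X (low i B) \<union> high i B"
  proof -
    have "i \<notin> toggle j w" if "j \<in> X" "i \<notin> w" for j
      using that assms(1) by (auto simp: toggle_def)
    then show ?thesis
      using assms by (auto simp: low_def high_def cube_nbhd_def)
  qed
  finally show "w \<in> low i (cube_nbhd (insert i X) B) \<longleftrightarrow> w \<in> cube_nbhd X (low i B) \<union> high i B" .
qed

lemma high_cube_nbhd:
  assumes "i \<notin> X" "B \<subseteq> Pow (insert i X)"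
  shows "high i (cube_nbhd (insert i X) B) = cube_nbhd X (high i B) \<union> low i B"
proof (rule set_eqI)
  fix w
  have t: "toggle j (insert i w) = insert i (toggle j w)" "i \<notin> w \<Longrightarrow> i \<notin> toggle j w" if "j \<in> X" for j
    using that assms(1) by (auto simp: toggle_def)
  have "w \<in> high i (cube_nbhd (insert i X) B) \<longleftrightarrow>
      w \<subseteq> X \<and> i \<notin> w \<and> (w \<in> B \<or> (\<exists>j\<in>X. insert i (toggle j w) \<in> B))"
    using t(1) by (auto simp: high_def cube_nbhd_def toggle_def[of i])
  also have "\<dots> \<longleftrightarrow> w \<in> cube_nbhd X (high i B) \<union> low i B"
    using assms t(2) by (auto simp: low_def high_def cube_nbhd_def)
  finally show "w \<in> high i (cube_nbhd (insert i X) B) \<longleftrightarrow> w \<in> cube_nbhd X (high i B) \<union> low i B" .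
qed

lemma initial_segments_card_Un:
  assumes "linear_order_on A r" "finite A" "initial_segment r A D" "initial_segment r A D'"
  shows "card (D \<union> D') = max (card D) (card D')"
  using initial_segment_nested[OF assms] initial_segment_nested[OF assms(1,2,4,3)]
  by (metis le_cases max.absorb1 max.absorb2 sup.absorb1 sup.absorb2)

lemma seg_is_seg: "finite X \<Longrightarrow> is_seg X p (seg X p k)"
  by (rule initial_segment_first_elems[OF cube_class_order])

text \<open>Each half of the neighbourhood is the union of the neighbourhood of one half of the
  family with the other half. After both are replaced by segments, such a union is nested and has
  the size of its larger part, which by induction is at most the size of the original union. The
  weight drops because at least one half was not a segment.\<close>

lemma compression:
  assumes X: "finite X" and i: "i \<notin> X" and B: "B \<subseteq> cube_class (insert i X) p"
    and IH: "\<And>p S. S \<subseteq> cube_class X p \<Longrightarrow> card (cube_nbhd X (seg X p (card S))) \<le> card (cube_nbhd X S)"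
    and f: "\<And>x y. x \<in> cube_class (insert i X) p \<Longrightarrow> y \<in> cube_class (insert i X) p \<Longrightarrow>
      weightlex_less x y \<Longrightarrow> (f x :: nat) < f y"
    and bad: "\<not> (is_seg X p (low i B) \<and> is_seg X (\<not> p) (high i B))"
  shows "\<exists>B' \<subseteq> cube_class (insert i X) p. card B' = card B \<and>
    card (cube_nbhd (insert i X) B') \<le> card (cube_nbhd (insert i X) B) \<and> sum f B' < sum f B"
proof -
  let ?X = "insert i X" and ?L = "low i B" and ?H = "high i B"
  have finB: "finite B"
    using B finite_cube_class[of ?X p] X by (auto intro: finite_subset)
  have LC: "?L \<subseteq> cube_class X p" and HC: "?H \<subseteq> cube_class X (\<not> p)"
    using low_cube_class[OF i B] high_cube_class[OF X i B] .
  define L where "L = seg X p (card ?L)"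
  define H where "H = seg X (\<not> p) (card ?H)"
  define B' where "B' = L \<union> insert i ` H"
  have LC': "L \<subseteq> cube_class X p" and HC': "H \<subseteq> cube_class X (\<not> p)"
    unfolding L_def H_def by (rule first_elems_subset)+
  have cL: "card L = card ?L" and cH: "card H = card ?H"
    unfolding L_def H_def using X LC HC
    by (auto intro!: card_first_elems cube_class_order card_mono finite_cube_class)
  have iLH: "\<forall>b\<in>L \<union> H. i \<notin> b"
    using LC' HC' i by (auto simp: cube_class_def)
  have lowB': "low i B' = L" and highB': "high i B' = H"
    unfolding B'_def using low_Un_insert[OF iLH] high_Un_insert[OF iLH] .
  have B'C: "B' \<subseteq> cube_class ?X p"
    unfolding B'_def using LC' HC' insert_cube_class[OF X i] by (auto simp: cube_class_def)
  have finB': "finite B'"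
    using B'C finite_cube_class[of ?X p] X by (auto intro: finite_subset)
  have "card B' = card B"
    using card_low_high[OF finB, of i] card_low_high[OF finB', of i] lowB' highB' cL cH by simp
  moreover have "card (cube_nbhd ?X B') \<le> card (cube_nbhd ?X B)"
  proof -
    have PowB: "B \<subseteq> Pow ?X" "B' \<subseteq> Pow ?X"
      using B B'C by (auto simp: cube_class_def)
    \<comment> \<open>Stated for any parity \<open>q\<close>, since it serves the low half with
      \<open>q = p\<close> and the high half with the opposite parity.\<close>
    have key: "card (cube_nbhd X (seg X q (card S)) \<union> seg X (\<not> q) (card T)) \<le> card (cube_nbhd X S \<union> T)"
      if "S \<subseteq> cube_class X q" "T \<subseteq> cube_class X (\<not> q)" for S T q
    proof -
      have fT: "finite T"
        using that(2) X finite_cube_class finite_subset by blast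
      have "card (cube_nbhd X (seg X q (card S)) \<union> seg X (\<not> q) (card T)) =
          max (card (cube_nbhd X (seg X q (card S)))) (card (seg X (\<not> q) (card T)))"
        using X by (intro initial_segments_card_Un[OF cube_class_order[of X "\<not> q"]]
            cube_nbhd_is_seg seg_is_seg) auto
      also have "card (seg X (\<not> q) (card T)) = card T"
        using X that(2) by (intro card_first_elems cube_class_order) (auto intro!: card_mono finite_cube_class)
      also have "max (card (cube_nbhd X (seg X q (card S)))) (card T) \<le> max (card (cube_nbhd X S)) (card T)"
        using IH[OF that(1)] by auto
      also have "\<dots> \<le> card (cube_nbhd X S \<union> T)"
        using fT X by (auto intro!: card_mono finite_cube_nbhd)
      finally show ?thesis .
    qed
    have "card (cube_nbhd ?X B') = card (cube_nbhd X L \<union> H) + card (cube_nbhd X H \<union> L)"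
      using card_low_high[OF finite_cube_nbhd[of ?X B'], of i] X PowB(2) i
      by (simp add: low_cube_nbhd high_cube_nbhd lowB' highB')
    also have "\<dots> \<le> card (cube_nbhd X ?L \<union> ?H) + card (cube_nbhd X ?H \<union> ?L)"
      using key[OF LC HC] key[OF HC, of ?L] LC unfolding L_def H_def by simp
    also have "\<dots> = card (cube_nbhd ?X B)"
      using card_low_high[OF finite_cube_nbhd[of ?X B], of i] X PowB(1) i
      by (simp add: low_cube_nbhd high_cube_nbhd)
    finally show ?thesis .
  qed
  moreover have "sum f B' < sum f B"
  proof -
    have segs: "is_seg X p L" "is_seg X (\<not> p) H"
      unfolding L_def H_def using X seg_is_seg by blast+
    have fL: "f x < f y" if "x \<in> cube_class X p" "y \<in> cube_class X p"
        "(x, y) \<in> weightlex_on (cube_class X p)" "x \<noteq> y" for x y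
      using that by (intro f) (auto simp: cube_class_def weightlex_on_def)
    \<comment> \<open>Inserting \<open>i\<close> preserves the order, so \<open>f\<close> composed
      with \<open>insert i\<close> is strictly increasing on the smaller class.\<close>
    have fH: "f (insert i x) < f (insert i y)" if xy: "x \<in> cube_class X (\<not> p)" "y \<in> cube_class X (\<not> p)"
        "(x, y) \<in> weightlex_on (cube_class X (\<not> p))" "x \<noteq> y" for x y
    proof (rule f)
      have "finite x" "finite y" "i \<notin> x" "i \<notin> y" "weightlex_less x y"
        using xy X i by (auto simp: cube_class_def weightlex_on_def intro: finite_subset)
      then show "weightlex_less (insert i x) (insert i y)"
        by (simp add: weightlex_less_insert)
    qed (use xy insert_cube_class[OF X i] in auto)
    have "sum f L \<le> sum f ?L" and L: "?L \<noteq> L \<Longrightarrow> sum f L < sum f ?L"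
      using sum_initial_segment_less[OF cube_class_order segs(1) LC _ _ fL] X cL
      by (cases "?L = L"; force)+
    moreover have "(\<Sum>b\<in>H. f (insert i b)) \<le> (\<Sum>b\<in>?H. f (insert i b))"
      and H: "?H \<noteq> H \<Longrightarrow> (\<Sum>b\<in>H. f (insert i b)) < (\<Sum>b\<in>?H. f (insert i b))"
      using sum_initial_segment_less[OF cube_class_order segs(2) HC _ _ fH] X cH
      by (cases "?H = H"; force)+
    moreover have "?L \<noteq> L \<or> ?H \<noteq> H"
      using bad segs by auto
    ultimately show ?thesis
      using sum_low_high[OF finB, of f i] sum_low_high[OF finB', of f i] lowB' highB' by fastforce
  qed
  ultimately show ?thesis
    using B'C by blast
qed

text \<open>Supplies the exchange step: adding \<open>x\<close> to a family that contains all its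
  predecessors creates no new neighbours. The gap forces \<open>x\<close> to contain the largest
  coordinate, and then every neighbour of \<open>x\<close> has another neighbour preceding
  \<open>x\<close>. With two coordinates this fails, as \<open>x\<close> is then the first of its
  class.\<close>

lemma exceptional_pair:
  assumes X: "finite X" "card X \<noteq> 2" and x: "x \<in> cube_class X p" and y: "X - x \<in> cube_class X p"
    and less: "weightlex_less x (X - x)"
    and gap: "\<And>z. z \<in> cube_class X p \<Longrightarrow> weightlex_less x z \<Longrightarrow> \<not> weightlex_less z (X - x)"
  shows "cube_nbhd X {x} \<subseteq> cube_nbhd X {z \<in> cube_class X p. weightlex_less z x}"
proof -
  let ?y = "X - x"
  have xX: "x \<subseteq> X" and fin: "finite x" "finite ?y" and par: "even (card x) \<longleftrightarrow> p" "even (card ?y) \<longleftrightarrow> p"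
    using x y X by (auto simp: cube_class_def intro: finite_subset)
  have cX: "card X = card x + card ?y"
    using xX X by (simp add: card_Diff_subset fin card_mono)
  have le: "card x \<le> card ?y"
    using less fin by (auto simp: weightlex_less_iff)
  have "X \<noteq> {}"
    using less xX weightlex_less_irrefl[of "{}"] by auto
  then have "card X \<noteq> 0"
    using X by simp
  \<comment> \<open>Complementary sets of the same parity make \<open>card X\<close> even; excluding
    0 and 2 leaves at least 4.\<close>
  moreover have "even (card X)"
    using cX par by simp
  ultimately have X4: "card X \<ge> 4"
    using X(2) by presburger
  have ne: "x \<noteq> {}"
  proof
    assume [simp]: "x = {}"
    \<comment> \<open>Any two-element set lies strictly between the empty set and
      \<open>X\<close>.\<close>
    obtain z where z: "z \<subseteq> X" "card z = 2" "finite z"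
      using obtain_subset_with_card_n[of 2 X] X4 by auto
    then have "z \<in> cube_class X p"
      using par by (auto simp: cube_class_def)
    then show False
      using gap[of z] z X4 X by (simp add: weightlex_less_iff)
  qed
  define M where "M = Max X"
  have MX: "M \<in> X" "\<And>a. a \<in> X \<Longrightarrow> a \<le> M"
    using X \<open>X \<noteq> {}\<close> by (auto simp: M_def)
  have Mx: "M \<in> x"
  proof (rule ccontr)
    assume Mx: "M \<notin> x"
    define m where "m = Max x"
    \<comment> \<open>Exchanging the largest element of \<open>x\<close> for the larger
      \<open>M\<close> gives a later set of the same size, which will turn out to precede the
      complement, against \<open>gap\<close>.\<close>
    define z where "z = insert M (x - {m})"
    have m: "m \<in> x" "\<And>a. a \<in> x \<Longrightarrow> a \<le> m"
      using fin ne by (auto simp: m_def)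
    then have "m < M"
      using MX(2)[of m] xX Mx by (auto simp: less_le)
    have zX: "z \<subseteq> X" "finite z"
      using MX xX fin by (auto simp: z_def)
    have cz: "card z = card x"
      using Mx m fin card_gt_0_iff[of x] by (auto simp: z_def)
    have "z \<in> cube_class X p"
      using zX cz par by (simp add: cube_class_def)
    moreover have "lex_less x z"
      unfolding lex_less_def using m \<open>m < M\<close> by (intro exI[of _ m]) (auto simp: z_def)
    then have "weightlex_less x z"
      using fin zX cz by (simp add: weightlex_less_iff)
    moreover have "weightlex_less z ?y"
    proof (cases "card x = card ?y")
      case False
      then show ?thesis
        using le cz fin zX by (simp add: weightlex_less_iff)
    next
      case True
      then obtain a where a: "a \<in> x" "\<forall>b<a. b \<in> x \<longleftrightarrow> b \<in> ?y"
        using less fin by (auto simp: weightlex_less_iff lex_less_def)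
      \<comment> \<open>Every element of \<open>X\<close> lies in exactly one of \<open>x\<close>
        and its complement, so their first difference is the least element of
        \<open>X\<close>.\<close>
      have above: "a \<le> b" if "b \<in> X" for b
        using a(2) that by (meson Diff_iff not_le)
      \<comment> \<open>A second element of \<open>x\<close> ensures that \<open>a\<close> is not
        the one exchanged, so \<open>z\<close> keeps the least element of \<open>X\<close>.\<close>
      have "\<exists>b. b \<in> x \<and> b \<noteq> a"
      proof (rule ccontr)
        assume "\<nexists>b. b \<in> x \<and> b \<noteq> a"
        then have "x = {a}"
          using a by blast
        then show False
          using True cX X4 by simp
      qed
      then obtain b where "b \<in> x" "b \<noteq> a"
        by blast
      then have "a < m"
        using above[of b] m(2)[of b] xX by auto
      then have "a \<in> z" "\<And>b. b < a \<Longrightarrow> b \<notin> X"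
        using a above by (auto simp: z_def dest: leD)
      then have "lex_less z ?y"
        unfolding lex_less_def using a zX by (intro exI[of _ a]) auto
      then show ?thesis
        using cz True zX fin by (simp add: weightlex_less_iff)
    qed
    ultimately show False
      using gap by blast
  qed
  show ?thesis
  proof
    fix w assume "w \<in> cube_nbhd X {x}"
    then obtain i where i: "i \<in> X" "toggle i w = x" "w \<subseteq> X"
      by (auto simp: cube_nbhd_def)
    then have w: "w = toggle i x"
      by auto
    \<comment> \<open>Two toggles restore the parity of \<open>x\<close>, so below only the order
      has to be checked.\<close>
    have *: "w \<in> cube_nbhd X {z \<in> cube_class X p. weightlex_less z x}"
      if "j \<in> X" "weightlex_less (toggle j w) x" for j
    proof -
      have "toggle j w \<in> cube_class X p"
        using toggle_cube_class[OF X(1) \<open>j \<in> X\<close> toggle_cube_class[OF X(1) i(1) x]] w by simp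
      then show ?thesis
        using that i(3) by (auto simp: cube_nbhd_def)
    qed
    show "w \<in> cube_nbhd X {z \<in> cube_class X p. weightlex_less z x}"
    proof (cases "i \<in> x")
      case False
      then have w: "w = insert i x" and "i < M"
        using w Mx MX(2)[OF i(1)] by (auto simp: toggle_def less_le)
      \<comment> \<open>After the insertion of \<open>i\<close>, deleting \<open>M\<close> instead
        of \<open>i\<close> amounts to exchanging \<open>M\<close> for a smaller element.\<close>
      have "toggle M w = insert i (x - {M})"
        using w Mx \<open>i < M\<close> by (auto simp: toggle_def)
      moreover have "card (insert i (x - {M})) = card x"
        using Mx False fin card_gt_0_iff[of x] by auto
      moreover have "lex_less (insert i (x - {M})) x"
        unfolding lex_less_def using False \<open>i < M\<close> by (intro exI[of _ i]) auto
      ultimately have "weightlex_less (toggle M w) x"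
        using fin by (simp add: weightlex_less_iff)
      then show ?thesis
        using * MX by blast
    next
      case True
      then have w: "w = x - {i}"
        using w by (simp add: toggle_def)
      show ?thesis
      proof (cases "w = {}")
        case False
        then obtain j where "j \<in> w"
          by blast
        then have "toggle j w = x - {i} - {j}" "j \<in> x - {i}" "j \<in> X"
          using w xX by (auto simp: toggle_def)
        moreover have "card (x - {i} - {j}) < card x"
          using fin True by (meson card_Diff1_less card_mono Diff_subset finite_Diff le_less_trans)
        ultimately show ?thesis
          using * fin by (simp add: weightlex_less_iff)
      next
        case True
        \<comment> \<open>Nothing is left to delete, so the other neighbour of \<open>w\<close> is
          the singleton of the least coordinate.\<close>
        then have "x = {M}"
          using w Mx by auto
        have "Min X \<noteq> M"
        proof
          assume "Min X = M"
          then have "X \<subseteq> {M}"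
            using MX(2) Min_le[OF X(1)] by (auto intro: antisym)
          then have "card X \<le> 1"
            using card_mono[of "{M}" X] by simp
          then show False
            using X4 by simp
        qed
        moreover have "Min X \<in> X"
          using X \<open>X \<noteq> {}\<close> by simp
        ultimately show ?thesis
          using *[of "Min X"] MX(2)[of "Min X"] \<open>x = {M}\<close> True
          by (simp add: toggle_def weightlex_less_singleton)
      qed
    qed
  qed
qed

text \<open>The square is a 4-cycle, hence complete bipartite between its classes. This covers the
  size left out of \<open>exceptional_pair\<close>.\<close>

lemma cube_nbhd_card_2:
  assumes X: "card X = 2" and y: "y \<in> cube_class X p"
  shows "cube_class X (\<not> p) \<subseteq> cube_nbhd X {y}"
proof
  fix w assume w: "w \<in> cube_class X (\<not> p)"
  obtain a b where ab: "X = {a, b}" "a \<noteq> b"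
    using X by (auto simp: card_2_iff)
  have sub: "y \<subseteq> X" "w \<subseteq> X" and par: "odd (card w) \<longleftrightarrow> even (card y)"
    using w y by (auto simp: cube_class_def)
  have "(a \<in> w \<longleftrightarrow> a \<in> y) \<noteq> (b \<in> w \<longleftrightarrow> b \<in> y)"
  proof
    assume eq: "(a \<in> w \<longleftrightarrow> a \<in> y) = (b \<in> w \<longleftrightarrow> b \<in> y)"
    show False
    proof (cases "a \<in> w \<longleftrightarrow> a \<in> y")
      case True
      then have "w = y"
        using eq sub ab(1) by blast
      then show False
        using par by simp
    next
      case False
      then have "w = X - y"
        using eq sub ab(1) by blast
      then have "card w = card X - card y"
        using sub(1) ab(1) by (simp add: card_Diff_subset finite_subset)
      moreover have "card y \<le> card X"
        using sub(1) ab(1) by (intro card_mono) auto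
      ultimately show False
        using par X by simp
    qed
  qed
  then consider "(a \<in> w) \<noteq> (a \<in> y)" "b \<in> w \<longleftrightarrow> b \<in> y" | "a \<in> w \<longleftrightarrow> a \<in> y" "(b \<in> w) \<noteq> (b \<in> y)"
    by blast
  then have "toggle a w = y \<or> toggle b w = y"
  proof cases
    case 1
    then show ?thesis
      using sub ab unfolding toggle_def by (intro disjI1) (cases "a \<in> w"; simp; blast)
  next
    case 2
    then show ?thesis
      using sub ab unfolding toggle_def by (intro disjI2) (cases "b \<in> w"; simp; blast)
  qed
  then show "w \<in> cube_nbhd X {y}"
    using sub ab(1) by (auto simp: cube_nbhd_def)
qed

theorem cube_class_isoperimetry:
  assumes "finite X" "A \<subseteq> cube_class X p"
  shows "card (cube_nbhd X (seg X p (card A))) \<le> card (cube_nbhd X A)"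
  using assms
\<comment> \<open>Both \<open>X\<close> and \<open>p\<close> vary, because compression uses the
  claim for both parities over \<open>X - {i}\<close>.\<close>
proof (induction "card X" arbitrary: X p A rule: less_induct)
  case less
  note X = \<open>finite X\<close>
  let ?C = "cube_class X p" and ?r = "weightlex_on (cube_class X p)"
  let ?f = "rank_in ?r ?C"
  note order = cube_class_order[OF X, of p]
  have f: "?f x < ?f y" if "x \<in> ?C" "y \<in> ?C" "weightlex_less x y" for x y
    using that weightlex_less_irrefl by (intro rank_in_less[OF order]) (auto simp: weightlex_on_def)
  \<comment> \<open>The competitors; \<open>A\<close> itself is one, so one of least rank sum
    exists.\<close>
  define P where "P B \<longleftrightarrow> B \<subseteq> ?C \<and> card B = card A \<and> card (cube_nbhd X B) \<le> card (cube_nbhd X A)" for B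
  obtain B where B: "P B" and min: "\<And>B'. P B' \<Longrightarrow> sum ?f B \<le> sum ?f B'"
    using less.prems(2) ex_has_least_nat[of P A "sum ?f"] unfolding P_def by blast
  have BC: "B \<subseteq> ?C" and cB: "card B = card A" and nB: "card (cube_nbhd X B) \<le> card (cube_nbhd X A)"
    using B by (auto simp: P_def)
  have finB: "finite B"
    using BC order(2) by (rule finite_subset)
  have compressed: "is_seg (X - {i}) p (low i B) \<and> is_seg (X - {i}) (\<not> p) (high i B)" if "i \<in> X" for i
  proof (rule ccontr)
    assume bad: "\<not> (is_seg (X - {i}) p (low i B) \<and> is_seg (X - {i}) (\<not> p) (high i B))"
    have eq: "insert i (X - {i}) = X"
      using that by blast
    have "\<exists>B' \<subseteq> ?C. card B' = card B \<and> card (cube_nbhd X B') \<le> card (cube_nbhd X B) \<and> sum ?f B' < sum ?f B"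
    proof (rule compression[of "X - {i}" i B p ?f, unfolded eq])
      show "card (cube_nbhd (X - {i}) (seg (X - {i}) q (card S))) \<le> card (cube_nbhd (X - {i}) S)"
        if "S \<subseteq> cube_class (X - {i}) q" for q S
        using less.hyps[OF card_Diff1_less[OF X \<open>i \<in> X\<close>] _ that] X by simp
    qed (use X BC bad f in auto)
    then obtain B' where B': "B' \<subseteq> ?C" "card B' = card B"
        "card (cube_nbhd X B') \<le> card (cube_nbhd X B)" "sum ?f B' < sum ?f B"
      by blast
    then have "P B'"
      using nB cB by (simp add: P_def)
    then show False
      using min B'(4) by fastforce
  qed
  \<comment> \<open>If \<open>x\<close> and \<open>z\<close> agree at some coordinate, they lie in
    the same half there, and that half, being an initial segment, would contain
    \<open>x\<close>.\<close>
  have compl: "z = X - x" if x: "x \<in> ?C" "x \<notin> B" and z: "z \<in> B" and xz: "weightlex_less x z" for x z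
  proof (rule ccontr)
    assume "z \<noteq> X - x"
    have xX: "x \<subseteq> X" and zX: "z \<subseteq> X"
      using x z BC by (auto simp: cube_class_def)
    obtain i where i: "i \<in> X" "i \<in> x \<longleftrightarrow> i \<in> z"
      using \<open>z \<noteq> X - x\<close> zX by auto
    show False
    proof (cases "i \<in> x")
      case False
      have "x \<in> cube_class (X - {i}) p" "z \<in> low i B"
        using x xX z i False by (auto simp: cube_class_def low_def)
      moreover have "is_seg (X - {i}) p (low i B)"
        using compressed[OF i(1)] ..
      ultimately have "x \<in> low i B"
        using xz unfolding initial_segment_weightlex_iff by blast
      then show False
        using x(2) by (simp add: low_def)
    next
      case True
      define x' z' where "x' = x - {i}" and "z' = z - {i}"
      have x': "x = insert i x'" "z = insert i z'" "i \<notin> x'" "i \<notin> z'"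
        using True i by (auto simp: x'_def z'_def)
      have fx': "finite x'" "finite z'"
        using xX zX X by (auto simp: x'_def z'_def intro: finite_subset)
      have "x' \<in> cube_class (X - {i}) (\<not> p)" "z' \<in> high i B"
        using x xX z x' fx' by (auto simp: cube_class_def high_def)
      moreover have "weightlex_less x' z'"
        using xz weightlex_less_insert[OF fx' x'(3,4)] x' by simp
      moreover have "is_seg (X - {i}) (\<not> p) (high i B)"
        using compressed[OF i(1)] ..
      ultimately have "x' \<in> high i B"
        unfolding initial_segment_weightlex_iff by blast
      then show False
        using x x' by (simp add: high_def)
    qed
  qed
  have "is_seg X p B"
  proof (rule ccontr)
    assume "\<not> is_seg X p B"
    then obtain x y where xy: "y \<in> B" "x \<in> ?C" "x \<notin> B" "weightlex_less x y"
      using BC by (auto simp: initial_segment_weightlex_iff)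
    have y: "y = X - x"
      using compl[OF xy(2,3,1,4)] .
    have xX: "x \<subseteq> X" and yC: "y \<in> ?C"
      using xy BC by (auto simp: cube_class_def)
    have fin: "finite z" if "z \<in> ?C" for z
      using that X cube_class_finite by blast
    \<comment> \<open>A missing set below \<open>y\<close> has \<open>y\<close> as its complement,
      so \<open>x\<close> is the only one.\<close>
    have below: "z \<in> B" if z: "z \<in> ?C" "weightlex_less z y" "z \<noteq> x" for z
    proof (rule ccontr)
      assume "z \<notin> B"
      then have "y = X - z"
        using compl[OF z(1) _ xy(1) z(2)] by blast
      moreover have "z \<subseteq> X"
        using z by (simp add: cube_class_def)
      ultimately show False
        using y z(3) xX by blast
    qed
    \<comment> \<open>A set strictly between would be a member of \<open>B\<close> above the missing
      \<open>x\<close>, hence equal to the complement \<open>y\<close>.\<close>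
    have gap: "\<not> weightlex_less z y" if z: "z \<in> ?C" "weightlex_less x z" for z
    proof
      assume zy: "weightlex_less z y"
      then have "z \<in> B"
        using below z weightlex_less_irrefl by blast
      then have "z = y"
        using compl[OF xy(2,3) _ z(2)] y by blast
      then show False
        using zy weightlex_less_irrefl by blast
    qed
    define B' where "B' = insert x (B - {y})"
    have B'C: "B' \<subseteq> ?C"
      using BC xy by (auto simp: B'_def)
    have "cube_nbhd X B' \<subseteq> cube_nbhd X B"
    proof (cases "card X = 2")
      case True
      have "cube_nbhd X B' \<subseteq> cube_class X (\<not> p)"
        using cube_nbhd_subset[OF X B'C] .
      also have "\<dots> \<subseteq> cube_nbhd X {y}"
        using cube_nbhd_card_2[OF True yC] .
      also have "\<dots> \<subseteq> cube_nbhd X B"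
        using xy by (intro cube_nbhd_mono) auto
      finally show ?thesis .
    next
      case False
      \<comment> \<open>All predecessors of \<open>x\<close> also lie below \<open>y\<close>, so
        they belong to \<open>B\<close> and \<open>exceptional_pair\<close> applies.\<close>
      have "{z \<in> ?C. weightlex_less z x} \<subseteq> B"
      proof
        fix z assume "z \<in> {z \<in> ?C. weightlex_less z x}"
        then have z: "z \<in> ?C" "weightlex_less z x" "z \<noteq> x"
          using weightlex_less_irrefl by auto
        then have "weightlex_less z y"
          using weightlex_less_trans[OF fin fin fin] xy yC by blast
        then show "z \<in> B"
          using below z by blast
      qed
      then have "cube_nbhd X {x} \<subseteq> cube_nbhd X B"
        using exceptional_pair[OF X False xy(2)] yC xy gap y cube_nbhd_mono by blast
      moreover have "cube_nbhd X (B - {y}) \<subseteq> cube_nbhd X B"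
        by (intro cube_nbhd_mono) auto
      ultimately show ?thesis
        using cube_nbhd_Un[of X "{x}" "B - {y}"] by (simp add: B'_def)
    qed
    then have "card (cube_nbhd X B') \<le> card (cube_nbhd X B)"
      by (intro card_mono finite_cube_nbhd X)
    moreover have "card B' = card B"
      using xy finB card_gt_0_iff[of B] by (auto simp: B'_def)
    ultimately have "P B'"
      using B'C cB nB by (simp add: P_def)
    moreover have "sum ?f B' < sum ?f B"
    proof -
      have "sum ?f B' = ?f x + sum ?f (B - {y})"
        using xy finB by (simp add: B'_def)
      also have "\<dots> < ?f y + sum ?f (B - {y})"
        using f[OF xy(2) yC xy(4)] by simp
      also have "\<dots> = sum ?f B"
        using xy finB by (simp add: sum.remove)
      finally show ?thesis .
    qed
    ultimately show False
      using min by fastforce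
  qed
  then have "B = seg X p (card A)"
    using initial_segment_eq_first_elems[OF order] cB by metis
  then show ?case
    using nB by simp
qed

section \<open>Hunters on graphs with isoperimetric nesting\<close>

lemma bipartition_sym: "bipartition G A B \<Longrightarrow> bipartition G B A"
  unfolding bipartition_def by auto

lemma bipartition_finite:
  assumes "bipartition G A B"
  shows "finite A"
proof -
  interpret pair_graph G
    using assms by (simp add: bipartition_def)
  have "finite (pverts G)"
    by (rule pair_finite_verts)
  then show ?thesis
    using assms by (auto simp: bipartition_def intro: finite_subset)
qed

lemma nbhd_subset_bipartition: "bipartition G A B \<Longrightarrow> S \<subseteq> A \<Longrightarrow> nbhd G S \<subseteq> B"
  unfolding bipartition_def nbhd_def by fast

lemma nbhd_mono: "S \<subseteq> T \<Longrightarrow> nbhd G S \<subseteq> nbhd G T"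
  by (auto simp: nbhd_def)

lemma nbhd_empty [simp]: "nbhd G {} = {}"
  by (simp add: nbhd_def)

lemma finite_mun_set: "finite A \<Longrightarrow> finite {card (nbhd G V) | V. V \<subseteq> A \<and> card V = k}"
  by (rule finite_subset[of _ "(\<lambda>V. card (nbhd G V)) ` Pow A"]) auto

lemma mun_le: "finite A \<Longrightarrow> V \<subseteq> A \<Longrightarrow> mun G A (card V) \<le> card (nbhd G V)"
  unfolding mun_def by (rule Min_le[OF finite_mun_set]) auto

lemma mun_attained:
  assumes "finite A" "k \<le> card A"
  obtains V where "V \<subseteq> A" "card V = k" "mun G A k = card (nbhd G V)"
proof -
  obtain W where "W \<subseteq> A" "card W = k"
    using obtain_subset_with_card_n[OF assms(2)] by metis
  then have "mun G A k \<in> {card (nbhd G V) | V. V \<subseteq> A \<and> card V = k}"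
    unfolding mun_def using assms(1) by (intro Min_in finite_mun_set) auto
  then show ?thesis
    using that by auto
qed

lemma mun_eqI:
  assumes "finite A" "W \<subseteq> A" "card W = k"
    and "\<And>V. V \<subseteq> A \<Longrightarrow> card V = k \<Longrightarrow> card (nbhd G W) \<le> card (nbhd G V)"
  shows "mun G A k = card (nbhd G W)"
  unfolding mun_def using assms by (intro Min_eqI finite_mun_set) auto

lemma mun_diff_le_u_max:
  assumes "1 \<le> k" "k \<le> card A"
  shows "int (mun G A k) - int k \<le> u_max G A"
proof -
  have "finite ((\<lambda>k. int (mun G A k) - int k) ` {1..card A})"
    by simp
  moreover have "{int (mun G A k) - int k | k. 1 \<le> k \<and> k \<le> card A} =
      (\<lambda>k. int (mun G A k) - int k) ` {1..card A}"
    by auto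
  ultimately show ?thesis
    unfolding u_max_def using assms by (intro Max_ge) auto
qed

lemma u_max_attained:
  assumes "1 \<le> card A"
  obtains k where "1 \<le> k" "k \<le> card A" "u_max G A = int (mun G A k) - int k"
proof -
  have eq: "{int (mun G A k) - int k | k. 1 \<le> k \<and> k \<le> card A} =
      (\<lambda>k. int (mun G A k) - int k) ` {1..card A}"
    by auto
  have "u_max G A \<in> (\<lambda>k. int (mun G A k) - int k) ` {1..card A}"
    unfolding u_max_def eq using assms by (intro Max_in) auto
  then show ?thesis
    using that by auto
qed

lemma u_max_cong:
  assumes "card A = card B" "\<And>k. k \<le> card A \<Longrightarrow> mun G A k = mun G B k"
  shows "u_max G A = u_max G B"
proof -
  have "{int (mun G A k) - int k | k. 1 \<le> k \<and> k \<le> card A} =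
      {int (mun G B k) - int k | k. 1 \<le> k \<and> k \<le> card B}"
    using assms(2) unfolding assms(1)[symmetric] by (intro Collect_cong) metis
  then show ?thesis
    by (simp add: u_max_def)
qed

section \<open>The lower bound for the number of hunters\<close>

lemma card_set_mset_le_size: "card (set_mset H) \<le> size H"
  by (induction H) (auto simp: card_insert_if)

text \<open>Only the positions in one class are tracked: \<open>A\<close> after an even number of
  rounds, \<open>B\<close> after an odd one. Because \<open>mun\<close> agrees on the two classes,
  one maximising \<open>k\<close> works throughout.\<close>

lemma territory_nonempty:
  assumes bip: "bipartition G A B" and card: "card A = card B" "1 \<le> card A"
    and mun: "\<And>k. k \<le> card A \<Longrightarrow> mun G A k = mun G B k"
    and h: "int h \<le> u_max G A" "\<And>H. H \<in> set Hs \<Longrightarrow> size H \<le> h"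
    and i: "i \<le> length Hs"
  shows "territory G Hs i \<noteq> {}"
proof -
  note fin = bipartition_finite[OF bip] bipartition_finite[OF bipartition_sym[OF bip]]
  obtain k where k: "1 \<le> k" "k \<le> card A" "u_max G A = int (mun G A k) - int k"
    using u_max_attained[OF card(2)] .
  have step: "mun G A k \<le> card (nbhd G (T - set_mset H) \<inter> D)"
    if bip: "bipartition G C D" and C: "card C = card A" "mun G C k = mun G A k"
      and T: "mun G A k \<le> card (T \<inter> C)" and H: "size H \<le> h" for C D T H
  proof -
    have finCD: "finite C" "finite D"
      using bip bipartition_sym bipartition_finite by blast+
    \<comment> \<open>The choice of \<open>k\<close> gives \<open>h + k \<le> mun G A k\<close>, so
      at least \<open>k\<close> positions survive the shots.\<close>
    have "k \<le> card (T \<inter> C) - card (set_mset H)"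
      using T H h(1) k(3) card_set_mset_le_size[of H] by simp
    also have "\<dots> \<le> card (T \<inter> C - set_mset H)"
      by (rule diff_card_le_card_Diff) simp
    finally obtain V where V: "V \<subseteq> T \<inter> C - set_mset H" "card V = k"
      by (rule obtain_subset_with_card_n) auto
    have "mun G C k \<le> card (nbhd G V)"
      using mun_le[OF finCD(1), of V] V by auto
    also have "nbhd G V \<subseteq> nbhd G (T - set_mset H) \<inter> D"
      using nbhd_mono[of V "T - set_mset H" G] nbhd_subset_bipartition[OF bip, of V] V by auto
    then have "card (nbhd G V) \<le> card (nbhd G (T - set_mset H) \<inter> D)"
      using finCD(2) by (intro card_mono) auto
    finally show ?thesis
      using C by simp
  qed
  have "mun G A k \<le> card (territory G Hs i \<inter> (if even i then A else B))"
    using i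
  proof (induction i)
    case 0
    \<comment> \<open>At the start all of \<open>A\<close> is possible, and a minimal neighbourhood
      fits into \<open>B\<close>, which has the same size.\<close>
    obtain V where V: "V \<subseteq> A" "mun G A k = card (nbhd G V)"
      using mun_attained[OF fin(1) k(2)] by blast
    have "card (nbhd G V) \<le> card B"
      using nbhd_subset_bipartition[OF bip V(1)] fin(2) by (intro card_mono)
    moreover have "pverts G \<inter> A = A"
      using bip by (auto simp: bipartition_def)
    ultimately show ?case
      using V(2) card(1) by simp
  next
    case (Suc i)
    have "Hs ! i \<in> set Hs"
      using Suc.prems by simp
    then have "size (Hs ! i) \<le> h"
      by (rule h(2))
    then show ?case
      using Suc step[OF bip] step[OF bipartition_sym[OF bip]] card(1) mun[OF k(2)] by auto
  qed
  moreover have "0 < mun G A k"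
    using k h(1) by linarith
  ultimately show ?thesis
    by fastforce
qed

section \<open>Clearing sets of positions, and the upper bound\<close>

definition pursue :: "'a pair_pre_digraph \<Rightarrow> 'a multiset list \<Rightarrow> 'a set \<Rightarrow> 'a set" where
  "pursue G Hs S = fold (\<lambda>H T. nbhd G (T - set_mset H)) Hs S"

lemma pursue_simps [simp]:
  "pursue G [] S = S"
  "pursue G (H # Hs) S = pursue G Hs (nbhd G (S - set_mset H))"
  "pursue G (Hs @ Hs') S = pursue G Hs' (pursue G Hs S)"
  by (simp_all add: pursue_def)

text \<open>Since \<open>pursue\<close> starts from any set and consumes the list, strategies can be
  concatenated and the start set split; \<open>territory\<close> is the case of all
  vertices.\<close>

lemma territory_eq_pursue:
  "i \<le> length Hs \<Longrightarrow> territory G Hs i = pursue G (take i Hs) (pverts G)"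
  by (induction i) (simp_all add: take_Suc_conv_app_nth)

lemma pursue_mono: "S \<subseteq> T \<Longrightarrow> pursue G Hs S \<subseteq> pursue G Hs T"
proof (induction Hs arbitrary: S T)
  case (Cons H Hs)
  have "nbhd G (S - set_mset H) \<subseteq> nbhd G (T - set_mset H)"
    using Cons.prems by (intro nbhd_mono) auto
  then show ?case
    using Cons.IH by simp
qed simp

text \<open>Shots and neighbourhoods act pointwise, so positions in the two classes evolve
  independently under the same shots.\<close>

lemma pursue_Un: "pursue G Hs (S \<union> T) = pursue G Hs S \<union> pursue G Hs T"
proof (induction Hs arbitrary: S T)
  case (Cons H Hs)
  have "nbhd G (S \<union> T - set_mset H) = nbhd G (S - set_mset H) \<union> nbhd G (T - set_mset H)"
    by (auto simp: nbhd_def)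
  then show ?case
    using Cons.IH by simp
qed simp

lemma pursue_empty [simp]: "pursue G Hs {} = {}"
  by (induction Hs) auto

lemma pursue_bipartition:
  "bipartition G A B \<Longrightarrow> S \<subseteq> A \<Longrightarrow> pursue G Hs S \<subseteq> A \<or> pursue G Hs S \<subseteq> B"
proof (induction Hs arbitrary: S A B)
  case (Cons H Hs)
  have "nbhd G (S - set_mset H) \<subseteq> B"
    using Cons.prems by (intro nbhd_subset_bipartition) auto
  then show ?case
    using Cons.IH[OF bipartition_sym[OF Cons.prems(1)]] by auto
qed simp

definition clearable :: "'a pair_pre_digraph \<Rightarrow> nat \<Rightarrow> 'a set \<Rightarrow> bool" where
  "clearable G h S \<longleftrightarrow>
     (\<exists>Hs. (\<forall>H\<in>set Hs. set_mset H \<subseteq> pverts G \<and> size H \<le> h) \<and> pursue G Hs S = {})"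

lemma clearable_empty: "clearable G h {}"
  unfolding clearable_def by (intro exI[of _ "[]"]) simp

lemma clearable_step:
  assumes "finite T" "T \<subseteq> pverts G" "card T \<le> h" "clearable G h (nbhd G (S - T))"
  shows "clearable G h S"
proof -
  obtain Hs where "\<forall>H\<in>set Hs. set_mset H \<subseteq> pverts G \<and> size H \<le> h" "pursue G Hs (nbhd G (S - T)) = {}"
    using assms(4) unfolding clearable_def by blast
  then show ?thesis
    unfolding clearable_def using assms(1-3) by (intro exI[of _ "mset_set T # Hs"]) auto
qed

text \<open>While \<open>A\<close> is being cleared, the positions that started in \<open>B\<close>
  swap classes together in each round and so end in a single class, which a second strategy then
  clears.\<close>

lemma clearable_bipartition:
  assumes "bipartition G A B" "clearable G h A" "clearable G h B"
  shows "clearable G h (pverts G)"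
proof -
  let ?ok = "\<lambda>Hs. \<forall>H\<in>set Hs. set_mset H \<subseteq> pverts G \<and> size H \<le> h"
  obtain Hs where Hs: "?ok Hs" "pursue G Hs A = {}"
    using assms(2) unfolding clearable_def by blast
  have V: "pverts G = A \<union> B"
    using assms(1) by (simp add: bipartition_def)
  \<comment> \<open>\<open>C\<close> is whichever of \<open>A\<close> and \<open>B\<close> contains
    the remaining positions.\<close>
  obtain C where C: "clearable G h C" "pursue G Hs B \<subseteq> C"
    using pursue_bipartition[OF bipartition_sym[OF assms(1)], of B Hs] assms(2,3) by blast
  obtain Hs' where Hs': "?ok Hs'" "pursue G Hs' C = {}"
    using C(1) unfolding clearable_def by blast
  have "pursue G (Hs @ Hs') (pverts G) = pursue G Hs' (pursue G Hs B)"
    using Hs(2) by (simp add: V pursue_Un)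
  also have "\<dots> \<subseteq> {}"
    using pursue_mono[OF C(2), of G Hs'] Hs'(2) by simp
  finally show ?thesis
    unfolding clearable_def using Hs(1) Hs'(1) by (intro exI[of _ "Hs @ Hs'"]) auto
qed

lemma hunter_number_le:
  assumes "clearable G h (pverts G)" "pverts G \<noteq> {}"
  shows "hunter_number G \<le> h"
proof -
  obtain Hs where Hs: "\<forall>H\<in>set Hs. set_mset H \<subseteq> pverts G \<and> size H \<le> h" "pursue G Hs (pverts G) = {}"
    using assms(1) unfolding clearable_def by blast
  \<comment> \<open>A nonempty list is demanded by \<open>hunter_strategy\<close> and keeps the
    maximum meaningful; the empty list would leave all vertices possible.\<close>
  have ne: "Hs \<noteq> []"
    using Hs(2) assms(2) by auto
  have "territory G Hs (length Hs) = {}"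
    using Hs(2) by (simp add: territory_eq_pursue)
  then have "winning_strategy G Hs"
    using Hs(1) ne unfolding winning_strategy_def hunter_strategy_def by blast
  then have "hunter_number G \<le> Max (size ` set Hs)"
    unfolding hunter_number_def by (intro cInf_lower) auto
  also have "\<dots> \<le> h"
    using Hs(1) ne by simp
  finally show ?thesis .
qed

text \<open>Shooting at the last \<^term>\<open>h\<close> vertices of an initial segment leaves an initial segment, which
  the next round moves to a strictly shorter initial segment of the other class.\<close>
lemma clearable_first_elems:
  assumes nest: "isoperimetric_nesting G A B rA rB" and card: "card A = card B"
    and u: "u_max G A < int h" "u_max G B < int h"
  shows "s \<le> card A \<Longrightarrow> clearable G h (first_elems rA A s) \<and> clearable G h (first_elems rB B s)"
proof (induction s rule: less_induct)
  case (less s)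
  have step: "clearable G h (first_elems r C s)"
    if nest: "isoperimetric_nesting G C D r r'" and C: "card C = card A" "card D = card A"
      and u: "u_max G C < int h"
      and IH: "\<And>t. t < s \<Longrightarrow> clearable G h (first_elems r' D t)" for C D r r'
  proof -
    have bip: "bipartition G C D" and lin: "linear_order_on C r"
      using nest by (auto simp: isoperimetric_nesting_def)
    have fin: "finite C"
      using bip by (rule bipartition_finite)
    let ?T = "first_elems r C s - first_elems r C (s - h)"
    have sub: "first_elems r C (s - h) \<subseteq> first_elems r C s"
      by (intro first_elems_mono) simp
    have rest: "first_elems r C s - ?T = first_elems r C (s - h)"
      using sub by blast
    have finT: "finite ?T" and TV: "?T \<subseteq> pverts G"
      using first_elems_subset[of r C s] fin bip by (auto simp: bipartition_def intro: finite_subset)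
    have "card ?T = s - (s - h)"
      using sub less.prems fin C(1)
      by (simp add: card_Diff_subset card_first_elems[OF lin fin] finite_subset[OF first_elems_subset])
    then have cT: "card ?T \<le> h"
      by simp
    have "clearable G h (nbhd G (first_elems r C (s - h)))"
    proof (cases "s \<le> h")
      \<comment> \<open>Truncated subtraction gives \<open>s - h = 0\<close>: the whole segment is
        shot.\<close>
      case True
      then show ?thesis
        by (simp add: first_elems_0[OF lin fin] clearable_empty)
    next
      case False
      then have k: "1 \<le> s - h" "s - h \<le> card C"
        using less.prems C(1) by auto
      \<comment> \<open>Here \<open>k = s - h\<close>, and the excess \<open>mun G C k - k\<close>
        is below \<open>h\<close>.\<close>
      have "mun G C (s - h) < s"
        using mun_diff_le_u_max[OF k, of G] u False by linarith
      moreover have "nbhd G (first_elems r C (s - h)) = first_elems r' D (mun G C (s - h))"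
        using nest k(2) by (simp add: isoperimetric_nesting_def)
      ultimately show ?thesis
        using IH by simp
    qed
    then show ?thesis
      using clearable_step[OF finT TV cT] rest by simp
  qed
  have nest': "isoperimetric_nesting G B A rB rA"
    using nest bipartition_sym[of G A B] by (simp add: isoperimetric_nesting_def)
  have IH: "clearable G h (first_elems rA A t)" "clearable G h (first_elems rB B t)" if "t < s" for t
    using less.IH[OF that] less.prems that by simp_all
  show ?case
    using step[OF nest refl card[symmetric] u(1) IH(2)] step[OF nest' card[symmetric] refl u(2) IH(1)]
    by simp
qed

text \<open>Equality of \<open>mun\<close> makes \<open>u_max\<close> agree on the two classes, so a
  single bound governs the rounds played in either.\<close>

theorem hunter_number_isoperimetric_nesting:
  assumes nest: "isoperimetric_nesting G A B rA rB" and card: "card A = card B" and ne: "A \<noteq> {}"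
    and mun: "\<And>k. k \<le> card A \<Longrightarrow> mun G A k = mun G B k"
  shows "int (hunter_number G) = u_max G A + 1"
proof -
  have bip: "bipartition G A B" and lin: "linear_order_on A rA" "linear_order_on B rB"
    using nest by (auto simp: isoperimetric_nesting_def)
  note fin = bipartition_finite[OF bip] bipartition_finite[OF bipartition_sym[OF bip]]
  have c1: "1 \<le> card A"
    using ne fin by (simp add: Suc_leI card_gt_0_iff)
  have uAB: "u_max G A = u_max G B"
    using u_max_cong[OF card mun] .
  define h where "h = nat (u_max G A + 1)"
  \<comment> \<open>The case \<open>k = 1\<close> shows that \<open>u_max G A\<close> is at least
    -1, so \<open>nat\<close> does not truncate.\<close>
  have h: "int h = u_max G A + 1"
    using mun_diff_le_u_max[of 1 A G] c1 by (simp add: h_def)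
  have V: "pverts G \<noteq> {}"
    using bip ne by (auto simp: bipartition_def)
  have "clearable G h A \<and> clearable G h B"
    using clearable_first_elems[OF nest card, of h "card A"] h uAB card
      first_elems_card[OF lin(1) fin(1)] first_elems_card[OF lin(2) fin(2)] by simp
  then have clear: "clearable G h (pverts G)"
    using clearable_bipartition[OF bip] by blast
  then have le: "hunter_number G \<le> h"
    using hunter_number_le V by blast
  \<comment> \<open>A winning strategy exists, so the infimum is attained by one, to which the lower
    bound can be applied.\<close>
  have "hunter_number G \<in> {Max (size ` set Hs) | Hs. winning_strategy G Hs}"
    unfolding hunter_number_def
  proof (rule Inf_nat_def1)
    obtain Hs where Hs: "\<forall>H\<in>set Hs. set_mset H \<subseteq> pverts G \<and> size H \<le> h" "pursue G Hs (pverts G) = {}"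
      using clear unfolding clearable_def by blast
    then have "Hs \<noteq> []"
      using V by auto
    then have "winning_strategy G Hs"
      using Hs territory_eq_pursue[of "length Hs" Hs G]
      unfolding winning_strategy_def hunter_strategy_def by auto
    then show "{Max (size ` set Hs) | Hs. winning_strategy G Hs} \<noteq> {}"
      by blast
  qed
  then obtain Hs where Hs: "winning_strategy G Hs" "hunter_number G = Max (size ` set Hs)"
    by blast
  then obtain i where i: "i \<le> length Hs" "territory G Hs i = {}"
    by (auto simp: winning_strategy_def)
  have "\<not> int (hunter_number G) \<le> u_max G A"
  proof
    assume le_u: "int (hunter_number G) \<le> u_max G A"
    have "size H \<le> hunter_number G" if "H \<in> set Hs" for H
      using that unfolding Hs(2) by (intro Max_ge) auto
    then show False
      using territory_nonempty[OF bip card c1 mun le_u _ i(1)] i(2) by blast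
  qed
  then show ?thesis
    using le h by linarith
qed

section \<open>The hypercube\<close>

lemma even_sets_eq: "even_sets n = cube_class {1..n} True"
  and odd_sets_eq: "odd_sets n = cube_class {1..n} False"
  by (auto simp: even_sets_def odd_sets_def cube_class_def)

lemma card_sym_diff_eq_1_iff: "card (sym_diff x y) = 1 \<longleftrightarrow> (\<exists>i. x = toggle i y)"
proof
  assume "card (sym_diff x y) = 1"
  then obtain i where "sym_diff x y = {i}"
    by (auto simp: card_1_singleton_iff)
  then have diff: "a \<in> x \<longleftrightarrow> (a \<in> y) \<noteq> (a = i)" for a
    by blast
  have "x = toggle i y"
    by (auto simp: toggle_def diff)
  then show "\<exists>i. x = toggle i y" ..
next
  assume "\<exists>i. x = toggle i y"
  then obtain i where "x = toggle i y" ..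
  then have "sym_diff x y = {i}"
    by (auto simp: toggle_def)
  then show "card (sym_diff x y) = 1"
    by simp
qed

lemma hypercube_arc_iff:
  "(x, y) \<in> parcs (hypercube n) \<longleftrightarrow> x \<subseteq> {1..n} \<and> y \<subseteq> {1..n} \<and> (\<exists>i\<in>{1..n}. x = toggle i y)"
proof -
  have "i \<in> {1..n}" if "x \<subseteq> {1..n}" "y \<subseteq> {1..n}" "x = toggle i y" for i
    using that by (auto simp: toggle_def split: if_splits)
  then show ?thesis
    unfolding hypercube_def by (auto simp only: card_sym_diff_eq_1_iff pair_pre_digraph.simps mem_Collect_eq case_prod_conv)
qed

lemma nbhd_hypercube:
  assumes "S \<subseteq> Pow {1..n}"
  shows "nbhd (hypercube n) S = cube_nbhd {1..n} S"
  using assms unfolding nbhd_def hypercube_arc_iff cube_nbhd_def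
  by (auto simp: hypercube_def)

lemma bipartition_hypercube: "bipartition (hypercube n) (even_sets n) (odd_sets n)"
proof -
  have arc: "(x, y) \<in> parcs (hypercube n) \<Longrightarrow> even (card x) \<longleftrightarrow> odd (card y)" for x y
    by (auto simp: hypercube_arc_iff even_card_toggle finite_subset)
  have V: "pverts (hypercube n) = Pow {1..n}"
    by (simp add: hypercube_def)
  have sub: "parcs (hypercube n) \<subseteq> Pow {1..n} \<times> Pow {1..n}"
    unfolding subset_iff split_paired_All hypercube_arc_iff by blast
  have "pair_graph (hypercube n)"
  proof
    fix e assume e: "e \<in> parcs (hypercube n)"
    then have "e \<in> Pow {1..n} \<times> Pow {1..n}"
      using sub by blast
    then show "fst e \<in> pverts (hypercube n)" "snd e \<in> pverts (hypercube n)"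
      unfolding V by (simp_all only: mem_Times_iff)
    show "fst e \<noteq> snd e"
      using e arc[of "fst e" "snd e"] by auto
  next
    have "sym (parcs (hypercube n))"
    proof (rule symI)
      fix x y assume "(x, y) \<in> parcs (hypercube n)"
      then show "(y, x) \<in> parcs (hypercube n)"
        unfolding hypercube_arc_iff using toggle_toggle by metis
    qed
    then show "symmetric (hypercube n)"
      by (simp add: symmetric_def)
  qed (use sub in \<open>auto simp: V intro: finite_subset\<close>)
  moreover have "even_sets n \<union> odd_sets n = pverts (hypercube n)" "even_sets n \<inter> odd_sets n = {}"
    by (auto simp: V even_sets_def odd_sets_def)
  moreover have "x \<in> even_sets n \<and> y \<in> odd_sets n \<or> x \<in> odd_sets n \<and> y \<in> even_sets n"
    if "(x, y) \<in> parcs (hypercube n)" for x y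
    using arc[OF that] sub that unfolding even_sets_def odd_sets_def by blast
  ultimately show ?thesis
    unfolding bipartition_def by blast
qed

lemma cube_class_Pow: "cube_class X p \<subseteq> Pow X"
  by (auto simp: cube_class_def)

lemma mun_hypercube:
  assumes "k \<le> card (cube_class {1..n} p)"
  shows "mun (hypercube n) (cube_class {1..n} p) k = card (cube_nbhd {1..n} (seg {1..n} p k))"
proof -
  let ?C = "cube_class {1..n} p"
  note order = cube_class_order[OF finite_atLeastAtMost, of 1 n p]
  have sub: "seg {1..n} p k \<subseteq> ?C"
    by (rule first_elems_subset)
  have nb: "nbhd (hypercube n) V = cube_nbhd {1..n} V" if "V \<subseteq> ?C" for V
    by (rule nbhd_hypercube[OF order_trans[OF that cube_class_Pow]])
  have "mun (hypercube n) ?C k = card (nbhd (hypercube n) (seg {1..n} p k))"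
  proof (rule mun_eqI[OF order(2) sub card_first_elems[OF order assms]])
    fix V assume "V \<subseteq> ?C" "card V = k"
    then show "card (nbhd (hypercube n) (seg {1..n} p k)) \<le> card (nbhd (hypercube n) V)"
      using cube_class_isoperimetry[of "{1..n}" V p] nb sub by auto
  qed
  then show ?thesis
    using nb[OF sub] by simp
qed

text \<open>The neighbourhood is an initial segment, hence determined by its size, which
  isoperimetry identifies as \<open>mun\<close>.\<close>

lemma nbhd_first_elems_hypercube:
  assumes "k \<le> card (cube_class {1..n} p)"
  shows "nbhd (hypercube n) (seg {1..n} p k) =
    seg {1..n} (\<not> p) (mun (hypercube n) (cube_class {1..n} p) k)"
proof -
  have "nbhd (hypercube n) (seg {1..n} p k) = cube_nbhd {1..n} (seg {1..n} p k)"
    by (rule nbhd_hypercube[OF order_trans[OF first_elems_subset cube_class_Pow]])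
  also have "\<dots> = seg {1..n} (\<not> p) (card (cube_nbhd {1..n} (seg {1..n} p k)))"
    by (intro initial_segment_eq_first_elems cube_class_order cube_nbhd_is_seg seg_is_seg) simp_all
  finally show ?thesis
    using mun_hypercube[OF assms] by simp
qed

lemma isoperimetric_nesting_hypercube:
  "isoperimetric_nesting (hypercube n) (even_sets n) (odd_sets n) (weightlex_even n) (weightlex_odd n)"
  unfolding isoperimetric_nesting_def
  using bipartition_hypercube[of n] nbhd_first_elems_hypercube[of _ n True]
    nbhd_first_elems_hypercube[of _ n False] cube_class_linear_order[of "{1..n}"]
  by (simp add: even_sets_eq odd_sets_eq)

section \<open>The symmetry between the two parity classes\<close>

lemma inj_toggle: "inj (toggle i)"
  by (rule inj_on_inverseI[of _ "toggle i"]) simp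

lemma toggle_image_cube_class:
  assumes "finite X" "i \<in> X"
  shows "toggle i ` cube_class X p = cube_class X (\<not> p)"
proof
  show "cube_class X (\<not> p) \<subseteq> toggle i ` cube_class X p"
  proof
    fix x assume "x \<in> cube_class X (\<not> p)"
    then have "toggle i x \<in> cube_class X p"
      using toggle_cube_class[OF assms, of x "\<not> p"] by simp
    then show "x \<in> toggle i ` cube_class X p"
      by (rule rev_image_eqI) simp
  qed
qed (use toggle_cube_class[OF assms] in auto)

lemma toggle_commute: "toggle i (toggle j x) = toggle j (toggle i x)"
  by (auto simp: toggle_def)

text \<open>Toggles commute, so toggling a fixed coordinate is an automorphism of the cube.\<close>

lemma cube_nbhd_toggle:
  assumes "i \<in> X"
  shows "cube_nbhd X (toggle i ` S) = toggle i ` cube_nbhd X S"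
proof -
  have sub: "cube_nbhd X (toggle i ` S) \<subseteq> toggle i ` cube_nbhd X S" for S
  proof
    fix w assume "w \<in> cube_nbhd X (toggle i ` S)"
    then obtain j x where j: "w \<subseteq> X" "j \<in> X" "x \<in> S" "toggle j w = toggle i x"
      by (auto simp: cube_nbhd_def)
    then have "x = toggle j (toggle i w)"
      by (metis toggle_commute toggle_toggle)
    then have "toggle i w \<in> cube_nbhd X S"
      using j toggle_subset[OF assms] by (auto simp: cube_nbhd_def)
    then show "w \<in> toggle i ` cube_nbhd X S"
      by (rule rev_image_eqI) simp
  qed
  \<comment> \<open>The converse inclusion is \<open>sub\<close> for the toggled family, toggled
    back.\<close>
  have "toggle i ` cube_nbhd X (toggle i ` toggle i ` S) \<subseteq> toggle i ` toggle i ` cube_nbhd X (toggle i ` S)"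
    by (intro image_mono sub)
  then have "toggle i ` cube_nbhd X S \<subseteq> cube_nbhd X (toggle i ` S)"
    by (simp add: image_image)
  with sub show ?thesis
    by blast
qed

text \<open>Toggling coordinate 1, available since \<open>n \<ge> 1\<close>, is an automorphism that
  exchanges the classes.\<close>

lemma mun_hypercube_even_odd:
  assumes n: "n \<ge> 1"
  shows "card (even_sets n) = card (odd_sets n)"
    and "mun (hypercube n) (even_sets n) k = mun (hypercube n) (odd_sets n) k"
proof -
  have 1: "1 \<in> {1..n}"
    using n by simp
  have inj: "inj_on (toggle 1) S" for S
    using inj_toggle by (rule inj_on_subset) simp
  have img: "toggle 1 ` even_sets n = odd_sets n" "toggle 1 ` odd_sets n = even_sets n"
    using toggle_image_cube_class[OF _ 1] by (simp_all add: even_sets_eq odd_sets_eq)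
  show "card (even_sets n) = card (odd_sets n)"
    using card_image[OF inj, of "even_sets n"] img(1) by simp
  \<comment> \<open>One inclusion for a general \<open>A\<close> suffices, as each class is the
    toggle of the other.\<close>
  have nbhd_cards: "{card (nbhd (hypercube n) V) | V. V \<subseteq> A \<and> card V = k}
      \<subseteq> {card (nbhd (hypercube n) V) | V. V \<subseteq> toggle 1 ` A \<and> card V = k}"
    if A: "A \<subseteq> Pow {1..n}" for A
  proof safe
    fix V assume V: "V \<subseteq> A"
    have "V \<subseteq> Pow {1..n}" "toggle 1 ` V \<subseteq> Pow {1..n}"
      using V A toggle_subset[OF 1] by blast+
    then have "nbhd (hypercube n) (toggle 1 ` V) = toggle 1 ` nbhd (hypercube n) V"
      using cube_nbhd_toggle[OF 1, of V] by (simp only: nbhd_hypercube)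
    then have "card (nbhd (hypercube n) (toggle 1 ` V)) = card (nbhd (hypercube n) V)"
      by (simp only: card_image[OF inj])
    moreover have "card (toggle 1 ` V) = card V"
      by (simp only: card_image[OF inj])
    ultimately show "\<exists>W. card (nbhd (hypercube n) V) = card (nbhd (hypercube n) W) \<and>
        W \<subseteq> toggle 1 ` A \<and> card W = card V"
      using V by (metis image_mono)
  qed
  have sub: "even_sets n \<subseteq> Pow {1..n}" "odd_sets n \<subseteq> Pow {1..n}"
    by (auto simp: even_sets_def odd_sets_def)
  have "{card (nbhd (hypercube n) V) | V. V \<subseteq> even_sets n \<and> card V = k} =
      {card (nbhd (hypercube n) V) | V. V \<subseteq> odd_sets n \<and> card V = k}"
    by (rule subset_antisym[OF nbhd_cards[OF sub(1), unfolded img] nbhd_cards[OF sub(2), unfolded img]])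
  then show "mun (hypercube n) (even_sets n) k = mun (hypercube n) (odd_sets n) k"
    by (simp add: mun_def)
qed

theorem theorem4p19:
  fixes n :: nat
  assumes "n \<ge> 1"
  shows "isoperimetric_nesting (hypercube n) (even_sets n) (odd_sets n)
           (weightlex_even n) (weightlex_odd n)
       \<and> int (hunter_number (hypercube n)) = u_max (hypercube n) (even_sets n) + 1"
proof
  show nest: "isoperimetric_nesting (hypercube n) (even_sets n) (odd_sets n)
      (weightlex_even n) (weightlex_odd n)"
    by (rule isoperimetric_nesting_hypercube)
  have "{} \<in> even_sets n"
    by (simp add: even_sets_def)
  then show "int (hunter_number (hypercube n)) = u_max (hypercube n) (even_sets n) + 1"
    using mun_hypercube_even_odd[OF assms]
    by (intro hunter_number_isoperimetric_nesting[OF nest]) auto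
qed

end
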